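(* Let $0<\alpha\le1$. An irrational number $x\in(0,1)$ is $\alpha$-normal if and only if it is $1$-normal; that is, the set of $\alpha$-normal numbers coincides with the set of $1$-normal numbers (the normal numbers with respect to the Gauss map $G=G_1$).
   Context: For $0<\alpha\le1$ let $\mathbb I_\alpha=[\alpha-1,\alpha)$. The $\alpha$-continued fraction map $G_\alpha:\mathbb I_\alpha\to\mathbb I_\alpha$ is $G_\alpha(0)=0$ and $G_\alpha(x)=\frac1{|x|}-\left\lfloor\frac1{|x|}+1-\alpha\right\rfloor$ for $x\ne0$; $G_1$ is the Gauss map. For irrational $x\in\mathbb I_\alpha$ and $n\ge1$ let $\varepsilon_{\alpha,n}(x)=\operatorname{sgn}(G_\alpha^{n-1}(x))$, $a_{\alpha,n}(x)=\left\lfloor\frac1{|G_\alpha^{n-1}(x)|}+1-\alpha\right\rfloor$ and $c_{\alpha,n}(x)=\varepsilon_{\alpha,n}(x)a_{\alpha,n}(x)$. For non-zero integers $b_1,\dots,b_n$ the cylinder set is $\langle b_1,\dots,b_n\rangle_\alpha=\{x\in\mathbb I_\alpha:c_{\alpha,1}(x)=b_1,\dots,c_{\alpha,n}(x)=b_n\}$. Let $\mu_\alpha$ be the absolutely continuous invariant probability measure for $G_\alpha$ (it is known to exist and be unique). An irrational $x\in\mathbb I_\alpha$ is normal with respect to $G_\alpha$ if for every $n\ge1$ and every cylinder set $\langle b_1,\dots,b_n\rangle_\alpha$, $$\lim_{N\to\infty}\frac1N\#\{0\le m\le N-1:G_\alpha^m(x)\in\langle b_1,\dots,b_n\rangle_\alpha\}=\mu_\alpha(\langle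 b_1,\dots,b_n\rangle_\alpha).$$ An irrational $x\in(0,1)$ is $\alpha$-normal if either $x\in[0,\alpha)$ and $x$ is normal with respect to $G_\alpha$, or $x\in[\alpha,1)$ and $x-1$ is normal with respect to $G_\alpha$. *)

theory Defs
  imports "HOL-Probability.Probability"
begin

definition I_alpha :: "real \<Rightarrow> real set" where
  "I_alpha \<alpha> = {\<alpha> - 1..<\<alpha>}"

definition G_alpha :: "real \<Rightarrow> real \<Rightarrow> real" where
  "G_alpha \<alpha> x = (if x = 0 then 0 else 1 / \<bar>x\<bar> - of_int \<lfloor>1 / \<bar>x\<bar> + 1 - \<alpha>\<rfloor>)"

definition cf_sign :: "real \<Rightarrow> nat \<Rightarrow> real \<Rightarrow> real" where
  "cf_sign \<alpha> n x = sgn ((G_alpha \<alpha> ^^ (n - 1)) x)"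

definition cf_quot :: "real \<Rightarrow> nat \<Rightarrow> real \<Rightarrow> int" where
  "cf_quot \<alpha> n x = \<lfloor>1 / \<bar>(G_alpha \<alpha> ^^ (n - 1)) x\<bar> + 1 - \<alpha>\<rfloor>"

text \<open>Digits are indexed from \<open>n = 1\<close>. If the orbit of a (rational) point has reached \<open>0\<close>, the
  digit is \<open>0\<close>, so such a point lies in no cylinder prescribing a non-zero digit at that index.\<close>

definition cf_digit :: "real \<Rightarrow> nat \<Rightarrow> real \<Rightarrow> real" where
  "cf_digit \<alpha> n x = cf_sign \<alpha> n x * of_int (cf_quot \<alpha> n x)"

definition cylinder :: "real \<Rightarrow> int list \<Rightarrow> real set" where
  "cylinder \<alpha> bs =
    {x \<in> I_alpha \<alpha>. \<forall>i\<in>{1..length bs}. cf_digit \<alpha> i x = of_int (bs ! (i - 1))}"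

definition is_acip :: "real \<Rightarrow> real measure \<Rightarrow> bool" where
  "is_acip \<alpha> M \<longleftrightarrow>
     prob_space M \<and>
     sets M = sets (restrict_space lborel (I_alpha \<alpha>)) \<and>
     absolutely_continuous (restrict_space lborel (I_alpha \<alpha>)) M \<and>
     G_alpha \<alpha> \<in> measurable M M \<and>
     distr M M (G_alpha \<alpha>) = M"

text \<open>The argument \<open>\<mu>\<close> is a family of measures; \<open>\<mu> \<alpha>\<close> is meant to be the absolutely continuous
  invariant probability measure of the map with parameter \<open>\<alpha>\<close>.\<close>

definition normal_wrt :: "(real \<Rightarrow> real measure) \<Rightarrow> real \<Rightarrow> real \<Rightarrow> bool" where
  "normal_wrt \<mu> \<alpha> x \<longleftrightarrow>
     x \<in> I_alpha \<alpha> \<and> x \<notin> \<rat> \<and>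
     (\<forall>bs::int list. bs \<noteq> [] \<and> 0 \<notin> set bs \<longrightarrow>
       (\<lambda>N. real (card {m. m < N \<and> (G_alpha \<alpha> ^^ m) x \<in> cylinder \<alpha> bs}) / real N)
         \<longlonglongrightarrow> measure (\<mu> \<alpha>) (cylinder \<alpha> bs))"

definition alpha_normal :: "(real \<Rightarrow> real measure) \<Rightarrow> real \<Rightarrow> real \<Rightarrow> bool" where
  "alpha_normal \<mu> \<alpha> x \<longleftrightarrow>
     x \<in> {0<..<1} \<and> x \<notin> \<rat> \<and>
     (x \<in> {0..<\<alpha>} \<and> normal_wrt \<mu> \<alpha> x \<or>
      x \<in> {\<alpha>..<1} \<and> normal_wrt \<mu> \<alpha> (x - 1))"

end

theory Submission
  imports Defs
begin

text \<open>Identify \<open>[\<alpha> - 1, \<alpha>)\<close> with \<open>[0, 1)\<close> modulo 1. In terms of \<open>u \<in> (0, 1)\<close>, the map \<open>G_alpha \<alpha>\<close> acts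
  as the Gauss map \<open>G\<close> if \<open>u < \<alpha>\<close>, as \<open>G \<circ> G\<close> if \<open>u \<ge> \<alpha>\<close> and \<open>u > 1/2\<close>, and as \<open>u \<mapsto> u / (1 - u)\<close>, which
  lowers the first Gauss digit by one, if \<open>\<alpha> \<le> u < 1/2\<close>. An orbit of \<open>G_alpha \<alpha>\<close> therefore enters the
  points \<open>g n\<close> of a Gauss orbit one after the other, spends boundedly many steps at each, and skips
  \<open>g (n + 1)\<close> exactly when it has entered \<open>g n \<ge> \<alpha>\<close>. Whether \<open>g n\<close> is entered is determined by the
  Gauss orbit since its last visit to \<open>[0, \<alpha>)\<close>, so for a Gauss-normal point all visit frequencies
  of the orbit of \<open>G_alpha \<alpha>\<close> converge, with limits that do not depend on the point. Lebesgue
  almost every point is Gauss-normal; hence integrating the frequencies against the invariant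
  measure \<open>\<mu> \<alpha>\<close> identifies these limits. Conversely the Gauss orbit is read off the orbit of
  \<open>G_alpha \<alpha>\<close> step by step, so for a point that is normal with respect to \<open>G_alpha \<alpha>\<close> its
  frequencies converge to limits that do not depend on the point, and a single point that is normal in
  both senses shows that these limits are the values of \<open>\<mu> 1\<close>.\<close>

section \<open>Sets with countable frontier\<close>

text \<open>The cut at \<alpha> is the obstacle: a cylinder of one map is in general not a finite
  union of cylinders of the other. Normality is therefore tested on sets with countable frontier.
  They include all cylinders, are closed under Boolean operations and under preimages by the maps of
  the coding, and their frontiers are null for every absolutely continuous measure. Thus no formula
  for the density of \<open>\<mu> \<alpha>\<close> enters, only absolute continuity, invariance and
  total mass one. Whether a Gauss point is entered depends on an unbounded past, so it is enclosed
  between two conditions on the last \<open>L\<close> points. These differ only where the Gauss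
  orbit avoids \<open>[0, \<alpha>)\<close> for \<open>L\<close> steps. Bounded distortion of the
  Gauss branches makes the measure of that set tend to 0, and the same estimate gives ergodicity.
  Both are proved for Lebesgue measure, because only Lebesgue null sets can be transferred to
  \<open>\<mu> \<alpha>\<close>. A block has at most \<open>nat \<lceil>1 / \<alpha>\<rceil>\<close>
  steps, as its Gauss point is at least \<alpha> whenever it has more than one.\<close>

lemma countable_frontier_Un:
  "countable (frontier A) \<Longrightarrow> countable (frontier B) \<Longrightarrow> countable (frontier (A \<union> B))"
  by (meson countable_Un countable_subset frontier_Un_subset)

lemma countable_frontier_Int:
  "countable (frontier A) \<Longrightarrow> countable (frontier B) \<Longrightarrow> countable (frontier (A \<inter> B))"
  by (meson countable_Un countable_subset frontier_Int_subset)

lemma countable_frontier_Compl: "countable (frontier A) \<Longrightarrow> countable (frontier (- A))"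
  by simp

lemma countable_frontier_atLeast: "countable (frontier {a::real..})"
  and countable_frontier_lessThan: "countable (frontier {..<(a::real)})"
  and countable_frontier_greaterThan: "countable (frontier {a::real<..})"
  and countable_frontier_atLeastLessThan: "countable (frontier {a::real..<b})"
proof -
  show 1: "countable (frontier {a::real..})" for a by simp
  have 2: "frontier {..<a} = frontier {a..}" for a::real
    using frontier_complement[of "{a..}"] by (simp add: Compl_atLeast)
  then show 3: "countable (frontier {..<(a::real)})" for a using 1 by metis
  have "frontier {a<..} = frontier {..a}" for a::real
    using frontier_complement[of "{..a}"] by (simp add: Compl_atMost)
  then show "countable (frontier {a::real<..})" by simp
  have "{a..<b} = {a..} \<inter> {..<b}" by auto
  then show "countable (frontier {a::real..<b})" using countable_frontier_Int[OF 1 3] by simp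
qed

text \<open>At a continuity point, an image in the interior of \<open>A\<close> or of its complement
  stays there for a whole neighbourhood, so the point is not a frontier point.\<close>

lemma frontier_vimage_subset:
  fixes f :: "real \<Rightarrow> real"
  assumes "\<And>x. x \<notin> D \<Longrightarrow> isCont f x"
  shows "frontier (f -` A) \<subseteq> D \<union> f -` frontier A"
proof
  fix x assume x: "x \<in> frontier (f -` A)"
  show "x \<in> D \<union> f -` frontier A"
  proof (rule ccontr)
    assume "x \<notin> D \<union> f -` frontier A"
    then have c: "isCont f x" and n: "f x \<in> interior A \<or> f x \<in> interior (- A)"
      using assms by (auto simp: frontier_interiors)
    have *: "x \<in> interior (f -` B)" if "f x \<in> interior B" for B
    proof -
      have "\<forall>\<^sub>F y in at x. f y \<in> interior B"
        using c that by (auto simp: isCont_def elim!: topological_tendstoD)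
      then obtain S where "open S" "x \<in> S" "\<forall>y\<in>S. y \<noteq> x \<longrightarrow> f y \<in> interior B"
        unfolding eventually_at_topological by blast
      have "f y \<in> B" if "y \<in> S" for y
        using \<open>\<forall>y\<in>S. y \<noteq> x \<longrightarrow> f y \<in> interior B\<close> \<open>f x \<in> interior B\<close> interior_subset[of B] that
        by (cases "y = x") auto
      then have "S \<subseteq> f -` B" by auto
      then show ?thesis using \<open>open S\<close> \<open>x \<in> S\<close> by (meson interiorI)
    qed
    from n have "x \<in> interior (f -` A) \<or> x \<in> interior (- (f -` A))"
      using *[of A] *[of "- A"] by (auto simp: vimage_Compl)
    then show False using x by (auto simp: frontier_interiors)
  qed
qed

lemma countable_vimage_of_fibres:
  assumes "countable C" "\<And>c. countable (f -` {c})"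
  shows "countable (f -` C)"
proof -
  have "f -` C = (\<Union>c\<in>C. f -` {c})" by auto
  then show ?thesis using assms by simp
qed

lemma countable_frontier_vimage:
  fixes f :: "real \<Rightarrow> real"
  assumes "countable D" "\<And>x. x \<notin> D \<Longrightarrow> isCont f x" "\<And>c. countable (f -` {c})"
    "countable (frontier A)"
  shows "countable (frontier (f -` A))"
  by (rule countable_subset[OF frontier_vimage_subset
        countable_Un[OF assms(1) countable_vimage_of_fibres[OF assms(4,3)]]]) (fact assms(2))

text \<open>Such a set is its open interior together with a countable set.\<close>

lemma borel_of_countable_frontier:
  fixes A :: "real set"
  assumes "countable (frontier A)" shows "A \<in> sets borel"
proof -
  have "A = interior A \<union> (A \<inter> frontier A)"
    using interior_subset[of A] interior_subset[of "- A"] by (auto simp: frontier_interiors)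
  moreover have "A \<inter> frontier A \<in> sets borel"
    by (rule sets.countable[OF _ countable_subset[OF Int_lower2 assms]]) simp
  ultimately show ?thesis by (metis borel_open open_interior sets.Un)
qed

section \<open>The map and its cylinders\<close>

text \<open>Integer form of the real-valued \<open>cf_digit\<close>, so that the digits of a point
  form an \<open>int list\<close> comparable with the list of a cylinder.\<close>

definition digit :: "real \<Rightarrow> real \<Rightarrow> int" where
  "digit \<alpha> z = (if z < 0 then - 1 else if z = 0 then 0 else 1) * \<lfloor>1 / \<bar>z\<bar> + 1 - \<alpha>\<rfloor>"

lemma cf_digit_eq: "cf_digit \<alpha> i x = of_int (digit \<alpha> ((G_alpha \<alpha> ^^ (i - 1)) x))"
proof -
  define z where "z = (G_alpha \<alpha> ^^ (i - 1)) x"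
  show ?thesis unfolding cf_digit_def cf_sign_def cf_quot_def digit_def z_def[symmetric] of_int_mult
    by (cases z "0::real" rule: linorder_cases) simp_all
qed

lemma ball_1_to_n: "(\<forall>i\<in>{1..n::nat}. P (i - 1)) \<longleftrightarrow> (\<forall>i<n. P i)"
proof -
  have "(\<forall>i\<in>Suc ` {..<n}. P (i - 1)) \<longleftrightarrow> (\<forall>i<n. P i)" by auto
  then show ?thesis by (simp only: image_Suc_lessThan)
qed

lemma cylinder_Nil: "cylinder \<alpha> [] = I_alpha \<alpha>"
  by (simp add: cylinder_def)

locale alpha_cf =
  fixes \<alpha> :: real
  assumes pos: "0 < \<alpha>" and le1: "\<alpha> \<le> 1"
begin

abbreviation "G \<equiv> G_alpha \<alpha>"
abbreviation "I \<equiv> I_alpha \<alpha>"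

lemma G_in_I: "G x \<in> I"
proof -
  have "real_of_int \<lfloor>y + 1 - \<alpha>\<rfloor> \<le> y + 1 - \<alpha>" "y + 1 - \<alpha> < real_of_int \<lfloor>y + 1 - \<alpha>\<rfloor> + 1" for y
    by simp_all
  then have "y - real_of_int \<lfloor>y + 1 - \<alpha>\<rfloor> \<in> I" for y
    unfolding I_alpha_def atLeastLessThan_iff by (smt (verit))
  then show ?thesis using pos le1 unfolding G_alpha_def I_alpha_def by auto
qed

lemma funpow_in_I: "x \<in> I \<Longrightarrow> (G ^^ n) x \<in> I"
  by (cases n) (auto simp: G_in_I)

lemma G_irrational:
  assumes "x \<notin> \<rat>" shows "G x \<notin> \<rat>"
proof
  have "x \<noteq> 0" using assms by auto
  assume "G x \<in> \<rat>"
  then have "1 / \<bar>x\<bar> \<in> \<rat>" using \<open>x \<noteq> 0\<close> unfolding G_alpha_def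
    by (metis Rats_add Rats_of_int diff_add_cancel)
  then have "1 / (1 / \<bar>x\<bar>) \<in> \<rat>" by (metis Rats_divide Rats_1)
  then show False using assms by (auto simp: abs_if split: if_splits)
qed

lemma funpow_irrational: "x \<notin> \<rat> \<Longrightarrow> (G ^^ n) x \<notin> \<rat>"
  by (induction n) (auto simp: G_irrational)

lemma abs_le_1: assumes "x \<in> I" shows "\<bar>x\<bar> \<le> 1"
  using assms pos le1 unfolding I_alpha_def atLeastLessThan_iff by linarith

lemma cylinder_Cons:
  "cylinder \<alpha> (b # bs) = {x \<in> I. digit \<alpha> x = b \<and> G x \<in> cylinder \<alpha> bs}" (is "?L = ?R")
proof (rule set_eqI)
  fix x
  have "(\<forall>i\<in>{1..length (b # bs)}. digit \<alpha> ((G ^^ (i - 1)) x) = (b # bs) ! (i - 1)) \<longleftrightarrow>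
    (\<forall>i<Suc (length bs). digit \<alpha> ((G ^^ i) x) = (b # bs) ! i)"
    using ball_1_to_n[of "length (b # bs)" "\<lambda>i. digit \<alpha> ((G ^^ i) x) = (b # bs) ! i"] by simp
  also have "\<dots> \<longleftrightarrow> digit \<alpha> x = b \<and> (\<forall>i<length bs. digit \<alpha> ((G ^^ i) (G x)) = bs ! i)"
    by (auto simp: All_less_Suc2 funpow_swap1)
  also have "(\<forall>i<length bs. digit \<alpha> ((G ^^ i) (G x)) = bs ! i) \<longleftrightarrow>
    (\<forall>i\<in>{1..length bs}. digit \<alpha> ((G ^^ (i - 1)) (G x)) = bs ! (i - 1))"
    using ball_1_to_n[of "length bs" "\<lambda>i. digit \<alpha> ((G ^^ i) (G x)) = bs ! i"] by simp
  finally show "x \<in> ?L \<longleftrightarrow> x \<in> ?R"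
    unfolding cylinder_def cf_digit_eq using G_in_I[of x] by auto
qed

lemma cylinder_subset: "cylinder \<alpha> bs \<subseteq> I"
  by (auto simp: cylinder_def)

lemma cylinder_disjoint:
  "length bs = length cs \<Longrightarrow> bs \<noteq> cs \<Longrightarrow> cylinder \<alpha> bs \<inter> cylinder \<alpha> cs = {}"
proof (induction bs cs rule: list_induct2)
  case (Cons b bs c cs) then show ?case by (cases "b = c") (auto simp: cylinder_Cons)
qed simp

lemma isCont_recip: "x \<noteq> 0 \<Longrightarrow> isCont (\<lambda>x::real. 1 / \<bar>x\<bar>) x"
  by (intro continuous_divide continuous_const isCont_rabs continuous_ident) simp

lemma finite_recip_fibre: "finite ((\<lambda>x::real. 1 / \<bar>x\<bar>) -` {c})"
proof (rule finite_subset)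
  show "(\<lambda>x::real. 1 / \<bar>x\<bar>) -` {c} \<subseteq> {1 / c, - 1 / c}"
    by (auto simp: abs_if field_simps split: if_splits)
qed simp

lemma countable_G_fibre: "countable (G -` {c})"
proof (rule countable_subset)
  show "G -` {c} \<subseteq> {0} \<union> (\<Union>k::int. (\<lambda>x::real. 1 / \<bar>x\<bar>) -` {c + k})"
    by (auto simp: G_alpha_def)
  show "countable ({0} \<union> (\<Union>k::int. (\<lambda>x::real. 1 / \<bar>x\<bar>) -` {c + k}))"
    using countable_finite[OF finite_recip_fibre] by (intro countable_Un countable_UN) simp_all
qed

text \<open>The excluded points are 0 and those at which the argument of the floor is an
  integer.\<close>

lemma isCont_G:
  assumes "x \<notin> {0} \<union> (\<Union>k::int. (\<lambda>x::real. 1 / \<bar>x\<bar>) -` {k - 1 + \<alpha>})"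
  shows "isCont G x"
proof -
  have x: "x \<noteq> 0" and k: "1 / \<bar>x\<bar> \<noteq> of_int k - 1 + \<alpha>" for k using assms by auto
  have n: "1 / \<bar>x\<bar> + 1 - \<alpha> \<notin> \<int>"
  proof
    assume "1 / \<bar>x\<bar> + 1 - \<alpha> \<in> \<int>"
    then obtain j where "1 / \<bar>x\<bar> + 1 - \<alpha> = of_int j" by (rule Ints_cases)
    then show False using k[of j] by linarith
  qed
  have 1: "isCont (\<lambda>x. 1 / \<bar>x\<bar> + 1 - \<alpha>) x"
    by (intro continuous_intros isCont_recip[OF x])
  have "isCont (\<lambda>x. real_of_int \<lfloor>1 / \<bar>x\<bar> + 1 - \<alpha>\<rfloor>) x"
    using isCont_o2[OF 1, of "\<lambda>y. real_of_int \<lfloor>y\<rfloor>"] continuous_floor[OF n] by (simp add: o_def)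
  then have "isCont (\<lambda>x. 1 / \<bar>x\<bar> - real_of_int \<lfloor>1 / \<bar>x\<bar> + 1 - \<alpha>\<rfloor>) x"
    using isCont_recip[OF x] by (intro continuous_diff)
  moreover have "\<forall>\<^sub>F y in nhds x. G y = 1 / \<bar>y\<bar> - real_of_int \<lfloor>1 / \<bar>y\<bar> + 1 - \<alpha>\<rfloor>"
    using t1_space_nhds[OF x] by eventually_elim (auto simp: G_alpha_def)
  ultimately show ?thesis by (simp add: isCont_cong)
qed

lemma countable_frontier_G_vimage:
  assumes "countable (frontier A)" shows "countable (frontier (G -` A))"
proof (rule countable_frontier_vimage[OF _ isCont_G countable_G_fibre assms])
  show "countable ({0} \<union> (\<Union>k::int. (\<lambda>x::real. 1 / \<bar>x\<bar>) -` {k - 1 + \<alpha>}))"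
    using countable_finite[OF finite_recip_fibre] by (intro countable_Un countable_UN) simp_all
qed

lemma countable_frontier_funpow_vimage:
  assumes "countable (frontier A)" shows "countable (frontier ((G ^^ n) -` A))"
proof (induction n)
  case (Suc n)
  have "(G ^^ Suc n) -` A = G -` ((G ^^ n) -` A)" unfolding funpow_Suc_right by (rule vimage_comp[symmetric])
  then show ?case using countable_frontier_G_vimage[OF Suc] by metis
qed (use assms in simp)

lemma countable_frontier_digit: "countable (frontier {x. digit \<alpha> x = b})"
proof -
  let ?h = "\<lambda>x::real. 1 / \<bar>x\<bar>"
  let ?F = "\<lambda>b::int. ?h -` {b - 1 + \<alpha>..<b + \<alpha>}"
  have F: "countable (frontier (?F b))" for b
    by (rule countable_frontier_vimage[of "{0}"])
      (use isCont_recip finite_recip_fibre countable_frontier_atLeastLessThan in \<open>auto intro: countable_finite\<close>)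
  have fl: "\<lfloor>?h x + 1 - \<alpha>\<rfloor> = b \<longleftrightarrow> x \<in> ?F b" for x b
    by (simp add: floor_eq_iff) linarith
  have *: "digit \<alpha> x = b \<longleftrightarrow> x < 0 \<and> x \<in> ?F (- b) \<or> x > 0 \<and> x \<in> ?F b \<or> x = 0 \<and> b = 0" for x
    unfolding digit_def fl[symmetric] by (cases "x < 0"; cases "x = 0") auto
  have "{x. digit \<alpha> x = b} = ({..<0} \<inter> ?F (-b)) \<union> ({0<..} \<inter> ?F b) \<union> (if b = 0 then {0} else {})"
    by (rule set_eqI) (use * in \<open>auto simp del: vimage_eq\<close>)
  moreover have "countable (frontier (if b = 0 then {0} else {}::real set))"
    by (auto intro: countable_subset[OF frontier_subset_closed])
  ultimately show ?thesis
    using countable_frontier_Un[OF countable_frontier_Un[OF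
      countable_frontier_Int[OF countable_frontier_lessThan[of 0] F[of "- b"]]
      countable_frontier_Int[OF countable_frontier_greaterThan[of 0] F[of b]]]]
    by metis
qed

lemma countable_frontier_I: "countable (frontier I)"
  unfolding I_alpha_def by (rule countable_frontier_atLeastLessThan)

lemma countable_frontier_cylinder: "countable (frontier (cylinder \<alpha> bs))"
proof (induction bs)
  case Nil then show ?case by (simp add: cylinder_Nil countable_frontier_I)
next
  case (Cons b bs)
  have "cylinder \<alpha> (b # bs) = I \<inter> ({x. digit \<alpha> x = b} \<inter> G -` cylinder \<alpha> bs)"
    by (auto simp: cylinder_Cons)
  then show ?case
    using countable_frontier_Int[OF countable_frontier_I countable_frontier_Int[OF
        countable_frontier_digit countable_frontier_G_vimage[OF Cons]]] by simp
qed

lemma cylinder_borel: "cylinder \<alpha> bs \<in> sets borel"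
  by (rule borel_of_countable_frontier[OF countable_frontier_cylinder])

lemma I_borel: "I \<in> sets borel" by (simp add: I_alpha_def)

lemma G_borel [measurable]: "G \<in> borel_measurable borel"
proof -
  have "G = (\<lambda>x. if x = 0 then 0 else 1 / \<bar>x\<bar> - of_int \<lfloor>1 / \<bar>x\<bar> + 1 - \<alpha>\<rfloor>)"
    by (auto simp: G_alpha_def)
  moreover have "(\<lambda>x::real. if x = 0 then 0 else 1 / \<bar>x\<bar> - of_int \<lfloor>1 / \<bar>x\<bar> + 1 - \<alpha>\<rfloor>) \<in> borel_measurable borel"
    by measurable
  ultimately show ?thesis by simp
qed

subsection \<open>Shrinking of cylinders\<close>

lemma quotient_ge_1:
  assumes "x \<in> I" "x \<noteq> 0" shows "1 \<le> \<lfloor>1 / \<bar>x\<bar> + 1 - \<alpha>\<rfloor>"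
proof -
  have "1 / \<bar>x\<bar> \<ge> 1" using abs_le_1[OF assms(1)] assms(2) by (simp add: field_simps)
  then have "1 / \<bar>x\<bar> \<ge> \<alpha>" using le1 by linarith
  then show ?thesis by linarith
qed

lemma digit_nonzero: assumes "x \<in> I" "x \<noteq> 0" shows "digit \<alpha> x \<noteq> 0"
proof -
  have "\<lfloor>1 / \<bar>x\<bar> + 1 - \<alpha>\<rfloor> \<noteq> 0" using quotient_ge_1[OF assms] by linarith
  then show ?thesis using assms(2) unfolding digit_def mult_eq_0_iff by simp
qed

text \<open>Two consecutive factors are needed because for \<alpha> = 1 a single point may be
  arbitrarily close to 1. There \<open>z * G z = 1 - z * n\<close> with \<open>n\<close> the
  quotient, and \<open>z \<le> z * n\<close> together with \<open>1 < z * n + z\<close> gives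
  \<open>z * n > 1/2\<close>. For \<alpha> < 1 the first factor alone is bounded away from
  1.\<close>

lemma product_contraction:
  obtains c where "0 < c" "c < 1" "\<And>z. z \<in> I \<Longrightarrow> \<bar>z * G z\<bar> \<le> c"
proof (cases "\<alpha> = 1")
  case True
  have "\<bar>z * G z\<bar> \<le> 1/2" if "z \<in> I" for z
  proof (cases "z = 0")
    case False
    have z: "0 < z" "z < 1" using that False True by (auto simp: I_alpha_def)
    define n where "n = \<lfloor>1 / z\<rfloor>"
    have n: "real_of_int n \<le> 1 / z" "1 / z < n + 1" unfolding n_def by linarith+
    have "1 < 1 / z" using z by simp
    then have n1: "1 \<le> n" unfolding n_def by linarith
    have "G z = 1 / z - n" using True z by (simp add: G_alpha_def n_def)
    then have e: "z * G z = 1 - z * n" using z by (simp add: field_simps)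
    have "z * n \<le> 1" "1 < z * n + z" using n z by (simp_all add: field_simps)
    moreover have "z * 1 \<le> z * n" using n1 z by (intro mult_left_mono) auto
    ultimately show ?thesis unfolding e by linarith
  qed simp
  then show ?thesis by (rule that[of "1/2", rotated 2]) auto
next
  case False
  let ?c = "max \<alpha> (1 - \<alpha>)"
  have b: "\<bar>z\<bar> \<le> ?c" if "z \<in> I" for z using that by (auto simp: I_alpha_def)
  have c: "0 < ?c" "?c < 1" using pos le1 False by auto
  have "\<bar>z * G z\<bar> \<le> ?c" if "z \<in> I" for z
  proof -
    have "\<bar>z\<bar> * \<bar>G z\<bar> \<le> ?c * 1" using b[OF that] abs_le_1[OF G_in_I] c by (intro mult_mono) auto
    then show ?thesis by (simp add: abs_mult)
  qed
  then show ?thesis by (rule that[OF c])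
qed

text \<open>Equal first digits give
  \<open>1 / \<bar>x\<bar> - 1 / \<bar>y\<bar> = G x - G y\<close>, so one step contributes exactly
  the factor \<open>\<bar>x\<bar> * \<bar>y\<bar>\<close>. The final 2 bounds the distance of two
  points of modulus at most 1.\<close>

lemma dist_in_cylinder:
  assumes "x \<in> cylinder \<alpha> bs" "y \<in> cylinder \<alpha> bs" "0 \<notin> set bs"
  shows "\<bar>x - y\<bar> \<le> (\<Prod>i<length bs. \<bar>(G ^^ i) x\<bar>) * (\<Prod>i<length bs. \<bar>(G ^^ i) y\<bar>) * 2"
  using assms
proof (induction bs arbitrary: x y)
  case Nil
  then have "\<bar>x\<bar> \<le> 1" "\<bar>y\<bar> \<le> 1" by (auto simp: cylinder_Nil abs_le_1)
  then show ?case by (simp add: abs_if split: if_splits)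
next
  case (Cons b bs)
  then have d: "digit \<alpha> x = b" "digit \<alpha> y = b" "b \<noteq> 0" "G x \<in> cylinder \<alpha> bs" "G y \<in> cylinder \<alpha> bs" "x \<in> I" "y \<in> I"
    by (auto simp: cylinder_Cons)
  then have n0: "x \<noteq> 0" "y \<noteq> 0" by (auto simp: digit_def)
  \<comment> \<open>A digit is sign times quotient and quotients of nonzero points are at least 1,
    so the digit determines both.\<close>
  have sg: "(x < 0 \<longleftrightarrow> y < 0) \<and> \<lfloor>1 / \<bar>x\<bar> + 1 - \<alpha>\<rfloor> = \<lfloor>1 / \<bar>y\<bar> + 1 - \<alpha>\<rfloor>"
  proof -
    define p q where "p = \<lfloor>1 / \<bar>x\<bar> + 1 - \<alpha>\<rfloor>" and "q = \<lfloor>1 / \<bar>y\<bar> + 1 - \<alpha>\<rfloor>"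
    have "1 \<le> p" "1 \<le> q" using quotient_ge_1[OF d(6) n0(1)] quotient_ge_1[OF d(7) n0(2)] by (simp_all add: p_def q_def)
    moreover have "(if x < 0 then - 1 else 1) * p = (if y < 0 then - 1 else 1) * q"
      using d(1,2) n0 unfolding digit_def p_def[symmetric] q_def[symmetric] by (simp split: if_splits)
    ultimately show ?thesis unfolding p_def[symmetric] q_def[symmetric] by (auto split: if_splits)
  qed
  then have "1 / \<bar>x\<bar> - 1 / \<bar>y\<bar> = G x - G y" using n0 by (simp add: G_alpha_def)
  then have "\<bar>y\<bar> - \<bar>x\<bar> = \<bar>x\<bar> * \<bar>y\<bar> * (G x - G y)" using n0 by (simp add: field_simps)
  then have "\<bar>x - y\<bar> = \<bar>x\<bar> * \<bar>y\<bar> * \<bar>G x - G y\<bar>"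
  proof -
    have "\<bar>x - y\<bar> = \<bar>\<bar>y\<bar> - \<bar>x\<bar>\<bar>" using sg[THEN conjunct1] by linarith
    also have "\<dots> = \<bar>\<bar>x\<bar> * \<bar>y\<bar> * (G x - G y)\<bar>" using \<open>\<bar>y\<bar> - \<bar>x\<bar> = _\<close> by simp
    finally show ?thesis by (simp add: abs_mult)
  qed
  also have "\<dots> \<le> \<bar>x\<bar> * \<bar>y\<bar> * ((\<Prod>i<length bs. \<bar>(G ^^ i) (G x)\<bar>) * (\<Prod>i<length bs. \<bar>(G ^^ i) (G y)\<bar>) * 2)"
    using Cons d by (intro mult_left_mono) auto
  also have "\<dots> = (\<Prod>i<Suc (length bs). \<bar>(G ^^ i) x\<bar>) * (\<Prod>i<Suc (length bs). \<bar>(G ^^ i) y\<bar>) * 2"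
    by (simp only: prod.lessThan_Suc_shift) (simp add: funpow_swap1 mult_ac)
  finally show ?case by simp
qed

lemma orbit_product_small:
  assumes "0 < e" obtains n where "0 < n" "\<And>m x. n \<le> m \<Longrightarrow> x \<in> I \<Longrightarrow> (\<Prod>i<m. \<bar>(G ^^ i) x\<bar>) < e"
proof -
  obtain c where c: "0 < c" "c < 1" "\<And>z. z \<in> I \<Longrightarrow> \<bar>z * G z\<bar> \<le> c" using product_contraction by blast
  have b: "(\<Prod>i<2*k. \<bar>(G ^^ i) x\<bar>) \<le> c ^ k" if "x \<in> I" for k x
  proof (induction k)
    case (Suc k)
    have "(\<Prod>i<2*Suc k. \<bar>(G ^^ i) x\<bar>) = (\<Prod>i<2*k. \<bar>(G ^^ i) x\<bar>) * \<bar>(G ^^ (2*k)) x * G ((G ^^ (2*k)) x)\<bar>"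
      by (simp add: abs_mult)
    also have "\<dots> \<le> c ^ k * c"
      using Suc c funpow_in_I[OF that] by (intro mult_mono) auto
    finally show ?case by (simp add: mult.commute)
  qed simp
  obtain k where k: "c ^ k < e" using real_arch_pow_inv[OF assms c(2)] by blast
  show ?thesis
  \<comment> \<open>The summand 1 makes the length positive even for \<open>k = 0\<close>; factors
    beyond the first \<open>2*k\<close> are at most 1.\<close>
  proof (rule that[of "2*k+1"])
    fix m x assume m: "2*k+1 \<le> m" and x: "x \<in> I"
    have "(\<Prod>i<m. \<bar>(G ^^ i) x\<bar>) = (\<Prod>i<2*k. \<bar>(G ^^ i) x\<bar>) * (\<Prod>i\<in>{2*k..<m}. \<bar>(G ^^ i) x\<bar>)"
      using prod.atLeastLessThan_concat[of 0 "2*k" m "\<lambda>i. \<bar>(G ^^ i) x\<bar>"] m by (simp add: atLeast0LessThan)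
    also have "\<dots> \<le> c ^ k * 1"
      using b[OF x] c abs_le_1[OF funpow_in_I[OF x]] by (intro mult_mono prod_le_1 prod_nonneg) auto
    finally show "(\<Prod>i<m. \<bar>(G ^^ i) x\<bar>) < e" using k by simp
  qed simp
qed

definition word :: "nat \<Rightarrow> real \<Rightarrow> int list" where
  "word n x = map (\<lambda>i. digit \<alpha> ((G ^^ i) x)) [0..<n]"

lemma length_word [simp]: "length (word n x) = n" by (simp add: word_def)

lemma mem_cylinder_iff: "x \<in> cylinder \<alpha> bs \<longleftrightarrow> x \<in> I \<and> word (length bs) x = bs"
proof -
  have "(\<forall>i\<in>{1..length bs}. digit \<alpha> ((G ^^ (i - 1)) x) = bs ! (i - 1)) \<longleftrightarrow>
    (\<forall>i<length bs. digit \<alpha> ((G ^^ i) x) = bs ! i)"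
    by (rule ball_1_to_n[of "length bs" "\<lambda>i. digit \<alpha> ((G ^^ i) x) = bs ! i"])
  then show ?thesis unfolding cylinder_def cf_digit_eq word_def list_eq_iff_nth_eq by auto
qed

lemma word_nonzero:
  assumes "x \<in> I" "x \<notin> \<rat>" shows "0 \<notin> set (word n x)"
proof -
  have "digit \<alpha> ((G ^^ i) x) \<noteq> 0" for i
    using funpow_in_I[OF assms(1), of i] funpow_irrational[OF assms(2), of i] by (intro digit_nonzero) auto
  then show ?thesis unfolding word_def by (auto simp: image_iff dest!: sym)
qed

text \<open>The product along the orbit of \<open>x\<close> alone makes the distance bound small;
  the factors belonging to the other point are merely bounded by 1.\<close>

lemma cylinder_word_in_open:
  assumes "open U" "x \<in> U" "x \<in> I" "x \<notin> \<rat>"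
  obtains n where "0 < n" "\<And>m. n \<le> m \<Longrightarrow> cylinder \<alpha> (word m x) \<subseteq> U"
proof -
  obtain e where e: "e > 0" "ball x e \<subseteq> U" using assms openE by blast
  obtain n where n: "0 < n" "\<And>m x. n \<le> m \<Longrightarrow> x \<in> I \<Longrightarrow> (\<Prod>i<m. \<bar>(G ^^ i) x\<bar>) < e/2"
    using orbit_product_small[of "e/2"] e by auto
  show ?thesis
  proof (rule that[OF n(1)])
    fix m assume m: "n \<le> m"
    show "cylinder \<alpha> (word m x) \<subseteq> U"
    proof
      fix y assume y: "y \<in> cylinder \<alpha> (word m x)"
      have x: "x \<in> cylinder \<alpha> (word m x)" using assms by (simp add: mem_cylinder_iff)
      have yI: "y \<in> I" using y cylinder_subset by blast
      have "\<bar>x - y\<bar> \<le> (\<Prod>i<m. \<bar>(G ^^ i) x\<bar>) * (\<Prod>i<m. \<bar>(G ^^ i) y\<bar>) * 2"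
        using dist_in_cylinder[OF x y word_nonzero[OF assms(3,4)]] by simp
      also have "\<dots> \<le> (\<Prod>i<m. \<bar>(G ^^ i) x\<bar>) * 1 * 2"
        using abs_le_1[OF funpow_in_I[OF yI]]
        by (intro mult_right_mono mult_left_mono prod_le_1 prod_nonneg) auto
      also have "\<dots> < e" using n(2)[OF m assms(3)] by simp
      finally show "y \<in> U" using e by (auto simp: dist_real_def)
    qed
  qed
qed

end

section \<open>Frequencies of sets with countable frontier\<close>

definition visits :: "('a \<Rightarrow> 'a) \<Rightarrow> 'a \<Rightarrow> 'a set \<Rightarrow> nat \<Rightarrow> nat" where
  "visits f x A N = card {m. m < N \<and> (f ^^ m) x \<in> A}"

lemma visits_mono: "A \<subseteq> B \<Longrightarrow> visits f x A N \<le> visits f x B N"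
  unfolding visits_def by (intro card_mono) auto

lemma visits_le: "visits f x A N \<le> N"
  using card_mono[of "{..<N}" "{m. m < N \<and> (f ^^ m) x \<in> A}"] by (auto simp: visits_def)

lemma visits_eq_sum: "real (visits f x A N) = (\<Sum>m<N. indicator A ((f ^^ m) x))"
proof -
  have "(\<Sum>m<N. indicator A ((f ^^ m) x)) = (\<Sum>m<N. if (f ^^ m) x \<in> A then 1 else 0 :: real)"
    by (intro sum.cong) (auto simp: indicator_def)
  also have "\<dots> = real (card ({..<N} \<inter> {m. (f ^^ m) x \<in> A}))"
    by (simp add: sum.If_cases)
  also have "{..<N} \<inter> {m. (f ^^ m) x \<in> A} = {m. m < N \<and> (f ^^ m) x \<in> A}" by auto
  finally show ?thesis by (simp add: visits_def)
qed

lemma visits_Compl: "real (visits f x (- A) N) = real N - real (visits f x A N)"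
  unfolding visits_eq_sum by (simp add: indicator_compl sum_subtractf)

lemma visits_UN_disjoint:
  assumes "finite B" "\<And>b c. b \<in> B \<Longrightarrow> c \<in> B \<Longrightarrow> b \<noteq> c \<Longrightarrow> C b \<inter> C c = {}"
  shows "real (visits f x (\<Union>b\<in>B. C b) N) = (\<Sum>b\<in>B. real (visits f x (C b) N))"
proof -
  have "real (visits f x (\<Union>b\<in>B. C b) N) = (\<Sum>m<N. \<Sum>b\<in>B. indicator (C b) ((f ^^ m) x))"
    unfolding visits_eq_sum using assms
    by (intro sum.cong refl indicator_UN_disjoint) (auto simp: disjoint_family_on_def)
  also have "\<dots> = (\<Sum>b\<in>B. real (visits f x (C b) N))"
    unfolding visits_eq_sum by (rule sum.swap)
  finally show ?thesis .
qed

context alpha_cf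
begin

lemma in_sets_restrict_I:
  "A \<in> sets (restrict_space lborel I) \<longleftrightarrow> A \<subseteq> I \<and> A \<in> sets borel"
  using I_borel by (subst sets_restrict_space_iff) auto

lemma rat_I_borel: "\<rat> \<inter> I \<in> sets borel"
  by (rule sets.countable) (simp, rule countable_Int1[OF countable_rat])

lemma cylinder_word_Suc: "cylinder \<alpha> (word (Suc n) x) \<subseteq> cylinder \<alpha> (word n x)"
  unfolding mem_cylinder_iff subset_iff word_def by simp

lemma mem_cylinder_word: "x \<in> I \<Longrightarrow> x \<in> cylinder \<alpha> (word n x)"
  by (simp add: mem_cylinder_iff)

text \<open>Inner approximation by finitely many cylinders in two limits: first the length, then a
  bound on the digits. The common length makes the cylinders disjoint, so their frequencies can be
  added. Rational points are discarded because their orbit may reach 0.\<close>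

lemma cylinders_exhaust_open:
  fixes N :: "real measure"
  assumes "finite_measure N" and sN: "sets N = sets (restrict_space lborel I)"
    and null: "measure N (\<rat> \<inter> I) = 0" and "open U" "0 < e"
  obtains n B where "0 < n" "finite B"
    "\<And>bs. bs \<in> B \<Longrightarrow> length bs = n \<and> 0 \<notin> set bs \<and> cylinder \<alpha> bs \<subseteq> U"
    "measure N (U \<inter> I) < measure N (\<Union>bs\<in>B. cylinder \<alpha> bs) + e"
proof -
  interpret finite_measure N by fact
  define L where "L n K = {bs. length bs = n \<and> set bs \<subseteq> {- int K..int K} - {0} \<and> cylinder \<alpha> bs \<subseteq> U}" for n K
  have finL: "finite (L n K)" for n K
    by (rule finite_subset[OF _ finite_lists_length_eq[of "{- int K..int K} - {0}" n]]) (auto simp: L_def)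
  define W where "W n K = (\<Union>bs\<in>L n K. cylinder \<alpha> bs)" for n K
  have W: "W n K \<in> sets N" for n K
    unfolding W_def by (intro sets.finite_UN finL) (simp add: sN in_sets_restrict_I cylinder_borel cylinder_subset)
  have inW: "x \<in> (\<Union>K. W n K)" if x: "x \<in> I" "x \<notin> \<rat>" "cylinder \<alpha> (word n x) \<subseteq> U" for x n
  proof -
    \<comment> \<open>Inserting 0 keeps the maximum defined for the empty word.\<close>
    define K where "K = nat (Max ((\<lambda>b. \<bar>b\<bar>) ` insert 0 (set (word n x))))"
    have "\<bar>b\<bar> \<le> int K" if "b \<in> set (word n x)" for b
    proof -
      have "\<bar>b\<bar> \<le> Max ((\<lambda>b. \<bar>b\<bar>) ` insert 0 (set (word n x)))" using that by (intro Max_ge) auto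
      then show ?thesis unfolding K_def by linarith
    qed
    then have "set (word n x) \<subseteq> {- int K..int K}" by (force simp: abs_le_iff)
    then have "word n x \<in> L n K" using x word_nonzero[OF x(1,2), of n] by (auto simp: L_def)
    then show ?thesis unfolding W_def using mem_cylinder_word[OF x(1)] by blast
  qed
  \<comment> \<open>The sets \<open>X n\<close> increase to the irrational points of
    \<open>U \<inter> I\<close>, and for fixed \<open>n\<close> the sets \<open>W n K\<close>
    exhaust \<open>X n\<close> up to rationals as \<open>K\<close> grows.\<close>
  define X where "X n = {x \<in> I - \<rat>. cylinder \<alpha> (word n x) \<subseteq> U}" for n
  have Xeq: "X n = (\<Union>K. W n K) - \<rat>" for n
  proof
    show "X n \<subseteq> (\<Union>K. W n K) - \<rat>" using inW by (auto simp: X_def)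
    show "(\<Union>K. W n K) - \<rat> \<subseteq> X n"
      using cylinder_subset by (auto simp: W_def L_def X_def mem_cylinder_iff)
  qed
  have Q: "A - \<rat> \<in> sets N" if "A \<in> sets N" for A
  proof -
    have "\<rat> \<inter> I \<in> sets N" using rat_I_borel by (simp add: sN in_sets_restrict_I)
    moreover have "A - \<rat> = A - (\<rat> \<inter> I)" using that by (auto simp: sN in_sets_restrict_I)
    ultimately show ?thesis using that by auto
  qed
  have X: "X n \<in> sets N" for n unfolding Xeq using W by (intro Q) auto
  have incX: "incseq X"
    by (rule incseq_SucI) (use cylinder_word_Suc in \<open>auto simp: X_def\<close>)
  have UX: "(\<Union>n. X n) = (U \<inter> I) - \<rat>"
  proof
    show "(\<Union>n. X n) \<subseteq> (U \<inter> I) - \<rat>" using mem_cylinder_word by (auto simp: X_def)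
    show "(U \<inter> I) - \<rat> \<subseteq> (\<Union>n. X n)"
    proof
      fix x assume x: "x \<in> (U \<inter> I) - \<rat>"
      then obtain n where "cylinder \<alpha> (word n x) \<subseteq> U"
        using cylinder_word_in_open[OF \<open>open U\<close>, of x] by (metis DiffD1 DiffD2 IntD1 IntD2 order_refl)
      then show "x \<in> (\<Union>n. X n)" using x by (auto simp: X_def)
    qed
  qed
  have UI: "U \<inter> I \<in> sets N" using \<open>open U\<close> I_borel by (auto simp: sN in_sets_restrict_I)
  have mU: "measure N ((U \<inter> I) - \<rat>) = measure N (U \<inter> I)"
  proof -
    have R: "\<rat> \<inter> I \<in> sets N" using rat_I_borel by (simp add: sN in_sets_restrict_I)
    have "measure N (U \<inter> I) \<le> measure N ((U \<inter> I - \<rat>) \<union> (\<rat> \<inter> I))"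
      using UI Q[OF UI] R by (intro finite_measure_mono) auto
    also have "\<dots> \<le> measure N (U \<inter> I - \<rat>) + measure N (\<rat> \<inter> I)"
      using Q[OF UI] R by (rule measure_Un_le)
    finally have "measure N (U \<inter> I) \<le> measure N (U \<inter> I - \<rat>)" using null by simp
    moreover have "measure N (U \<inter> I - \<rat>) \<le> measure N (U \<inter> I)" using UI by (intro finite_measure_mono) auto
    ultimately show ?thesis by simp
  qed
  have "(\<lambda>n. measure N (X n)) \<longlonglongrightarrow> measure N (U \<inter> I)"
    using finite_Lim_measure_incseq[of X] X incX UX mU by auto
  then have "\<forall>\<^sub>F n in sequentially. measure N (X n) > measure N (U \<inter> I) - e/2"
    using \<open>0 < e\<close> by (intro order_tendstoD) auto
  then have "\<forall>\<^sub>F n in sequentially. 0 < n \<and> measure N (X n) > measure N (U \<inter> I) - e/2"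
    using eventually_gt_at_top[of 0] by eventually_elim auto
  then obtain n where n: "0 < n" "measure N (X n) > measure N (U \<inter> I) - e/2"
    using eventually_happens'[OF sequentially_bot] by blast
  have incW: "incseq (W n)"
  proof (rule incseq_SucI)
    fix K have "L n K \<subseteq> L n (Suc K)" by (auto simp: L_def)
    then show "W n K \<subseteq> W n (Suc K)" unfolding W_def by blast
  qed
  have "(\<lambda>K. measure N (W n K)) \<longlonglongrightarrow> measure N (\<Union>K. W n K)"
    using W incW by (intro finite_Lim_measure_incseq) auto
  moreover have "measure N (\<Union>K. W n K) > measure N (U \<inter> I) - e"
  proof -
    have "measure N (X n) \<le> measure N (\<Union>K. W n K)"
      unfolding Xeq using W by (intro finite_measure_mono) auto
    then show ?thesis using n \<open>0 < e\<close> by linarith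
  qed
  ultimately have "\<forall>\<^sub>F K in sequentially. measure N (W n K) > measure N (U \<inter> I) - e"
    by (rule order_tendstoD)
  then obtain K where K: "measure N (W n K) > measure N (U \<inter> I) - e"
    using eventually_happens'[OF sequentially_bot] by blast
  show ?thesis
  proof (rule that[OF n(1) finL[of n K]])
    show "length bs = n \<and> 0 \<notin> set bs \<and> cylinder \<alpha> bs \<subseteq> U" if "bs \<in> L n K" for bs
      using that by (auto simp: L_def)
    show "measure N (U \<inter> I) < measure N (\<Union>bs\<in>L n K. cylinder \<alpha> bs) + e"
      using K unfolding W_def by simp
  qed
qed

end

section \<open>Normality tested on sets with countable frontier\<close>

locale alpha_acip = alpha_cf +
  fixes M :: "real measure"
  assumes acip: "is_acip \<alpha> M"
begin

sublocale prob_space M using acip by (simp add: is_acip_def)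

lemma sets_M: "sets M = sets (restrict_space lborel I)"
  using acip by (simp add: is_acip_def)

lemma mem_sets_M: "A \<in> sets M \<longleftrightarrow> A \<subseteq> I \<and> A \<in> sets borel"
  by (simp add: sets_M in_sets_restrict_I)

lemma space_M: "space M = I"
  using sets_eq_imp_space_eq[OF sets_M] by (simp add: space_restrict_space)

lemma measurable_G_M: "G \<in> measurable M M" and distr_G_M: "distr M M G = M"
  using acip by (auto simp: is_acip_def)

lemma null_sets_M: assumes "A \<in> null_sets lborel" "A \<subseteq> I" shows "A \<in> null_sets M"
proof -
  have "A \<in> null_sets (restrict_space lborel I)"
    using assms I_borel by (subst null_sets_restrict_space) auto
  then show ?thesis using acip by (auto simp: is_acip_def absolutely_continuous_def)
qed

lemma AE_M_of_lborel:
  assumes "AE x in lborel. x \<in> I \<longrightarrow> P x" shows "AE x in M. P x"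
proof -
  obtain Z where Z: "{x \<in> space lborel. \<not> (x \<in> I \<longrightarrow> P x)} \<subseteq> Z" "emeasure lborel Z = 0" "Z \<in> sets lborel"
    using AE_E[OF assms] .
  have "Z \<inter> I \<in> null_sets M"
    using Z I_borel by (intro null_sets_M null_set_Int2) auto
  moreover have "{x \<in> space M. \<not> P x} \<subseteq> Z \<inter> I" using Z by (auto simp: space_M)
  ultimately show ?thesis by (rule AE_I')
qed

lemma measure_countable: assumes "countable C" shows "measure M (C \<inter> I) = 0"
proof -
  have "C \<inter> I \<in> null_sets M"
    using countable_imp_null_set_lborel[of "C \<inter> I"] assms by (intro null_sets_M) auto
  then show ?thesis by (rule measure_eq_0_null_sets)
qed

lemma measure_interior_eq:
  assumes "countable (frontier A)" shows "measure M (interior A \<inter> I) = measure M (A \<inter> I)"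
proof (rule antisym)
  have A: "A \<inter> I \<in> sets M" and i: "interior A \<inter> I \<in> sets M" and F: "frontier A \<inter> I \<in> sets M"
    using borel_of_countable_frontier[OF assms] I_borel by (auto simp: mem_sets_M)
  show "measure M (interior A \<inter> I) \<le> measure M (A \<inter> I)"
    using A interior_subset[of A] by (intro finite_measure_mono) auto
  have "measure M (A \<inter> I) \<le> measure M ((interior A \<inter> I) \<union> (frontier A \<inter> I))"
    using i F interior_subset[of "- A"] by (intro finite_measure_mono) (auto simp: frontier_interiors)
  also have "\<dots> \<le> measure M (interior A \<inter> I) + measure M (frontier A \<inter> I)"
    using i F by (rule measure_Un_le)
  finally show "measure M (A \<inter> I) \<le> measure M (interior A \<inter> I)"
    using measure_countable[OF assms] by simp
qed

text \<open>The requirement is made for all sets with countable frontier, the class preserved by the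
  coding below; \<open>normal_iff_cylinders\<close> shows that cylinders suffice.\<close>

definition normal :: "real \<Rightarrow> bool" where
  "normal x \<longleftrightarrow> x \<in> I \<and> x \<notin> \<rat> \<and>
     (\<forall>A. countable (frontier A) \<longrightarrow> (\<lambda>N. visits G x A N / N) \<longlonglongrightarrow> measure M (A \<inter> I))"

lemma visits_open_liminf:
  assumes cyl: "\<And>bs. bs \<noteq> [] \<Longrightarrow> 0 \<notin> set bs \<Longrightarrow>
      (\<lambda>N. visits G x (cylinder \<alpha> bs) N / N) \<longlonglongrightarrow> measure M (cylinder \<alpha> bs)"
    and "open U" "0 < e"
  shows "\<forall>\<^sub>F N in sequentially. measure M (U \<inter> I) - e < visits G x U N / N"
proof -
  obtain n B where nB: "0 < n" "finite B"
    "\<And>bs. bs \<in> B \<Longrightarrow> length bs = n \<and> 0 \<notin> set bs \<and> cylinder \<alpha> bs \<subseteq> U"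
    "measure M (U \<inter> I) < measure M (\<Union>bs\<in>B. cylinder \<alpha> bs) + e"
    using cylinders_exhaust_open[OF finite_measure_axioms sets_M measure_countable[OF countable_rat] assms(2,3)]
    by metis
  let ?V = "\<Union>bs\<in>B. cylinder \<alpha> bs"
  have dis: "cylinder \<alpha> b \<inter> cylinder \<alpha> c = {}" if "b \<in> B" "c \<in> B" "b \<noteq> c" for b c
    using nB(3) that by (metis cylinder_disjoint)
  have "measure M ?V = (\<Sum>b\<in>B. measure M (cylinder \<alpha> b))"
    using dis by (intro finite_measure_finite_Union nB)
      (auto simp: disjoint_family_on_def mem_sets_M cylinder_borel cylinder_subset[THEN subsetD])
  moreover have "(\<lambda>N. \<Sum>b\<in>B. visits G x (cylinder \<alpha> b) N / N) \<longlonglongrightarrow> (\<Sum>b\<in>B. measure M (cylinder \<alpha> b))"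
    using nB by (intro tendsto_sum cyl) auto
  ultimately have "(\<lambda>N. visits G x ?V N / N) \<longlonglongrightarrow> measure M ?V"
    using visits_UN_disjoint[OF nB(2), of "cylinder \<alpha>" G x] dis by (simp add: sum_divide_distrib)
  then have "\<forall>\<^sub>F N in sequentially. measure M (U \<inter> I) - e < visits G x ?V N / N"
    using nB(4) by (intro order_tendstoD) auto
  then show ?thesis
  proof eventually_elim
    case (elim N)
    have "visits G x ?V N \<le> visits G x U N" using nB(3) by (intro visits_mono) auto
    then have "real (visits G x ?V N) / N \<le> visits G x U N / N" by (intro divide_right_mono) auto
    then show ?case using elim by linarith
  qed
qed

text \<open>A portmanteau argument: open sets are approximated from inside by cylinders, which
  bounds the frequencies of the interior of \<open>A\<close> from below. The frontier is null, so
  this is the right lower bound for \<open>A\<close>; the complement gives the upper bound.\<close>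

lemma normal_iff_cylinders:
  "normal x \<longleftrightarrow> x \<in> I \<and> x \<notin> \<rat> \<and> (\<forall>bs. bs \<noteq> [] \<longrightarrow> 0 \<notin> set bs \<longrightarrow>
      (\<lambda>N. visits G x (cylinder \<alpha> bs) N / N) \<longlonglongrightarrow> measure M (cylinder \<alpha> bs))" (is "_ \<longleftrightarrow> ?R")
proof
  assume "normal x"
  moreover have "cylinder \<alpha> bs \<inter> I = cylinder \<alpha> bs" for bs using cylinder_subset by auto
  ultimately show ?R unfolding normal_def using countable_frontier_cylinder by metis
next
  assume R: ?R
  have "(\<lambda>N. visits G x A N / N) \<longlonglongrightarrow> measure M (A \<inter> I)" if A: "countable (frontier A)" for A
  proof (rule order_tendstoI)
    have lower: "\<forall>\<^sub>F N in sequentially. a < visits G x A N / N"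
      if A: "countable (frontier A)" and a: "a < measure M (A \<inter> I)" for a A
    proof -
      have "\<forall>\<^sub>F N in sequentially. measure M (interior A \<inter> I) - (measure M (A \<inter> I) - a) < visits G x (interior A) N / N"
        using R a by (intro visits_open_liminf) auto
      then show ?thesis
      proof eventually_elim
        case (elim N)
        have "real (visits G x (interior A) N) / N \<le> visits G x A N / N"
          using visits_mono[OF interior_subset] by (intro divide_right_mono) auto
        then show ?case using elim measure_interior_eq[OF A] by linarith
      qed
    qed
    show "\<forall>\<^sub>F N in sequentially. a < visits G x A N / N" if "a < measure M (A \<inter> I)" for a
      using lower[OF A that] .
    show "\<forall>\<^sub>F N in sequentially. visits G x A N / N < a" if "measure M (A \<inter> I) < a" for a
    proof -
      have "A \<inter> I \<in> sets M" using borel_of_countable_frontier[OF A] I_borel by (auto simp: mem_sets_M)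
      moreover have "(- A) \<inter> I = space M - A \<inter> I" by (auto simp: space_M)
      ultimately have "measure M ((- A) \<inter> I) = 1 - measure M (A \<inter> I)" using prob_compl by metis
      then have "\<forall>\<^sub>F N in sequentially. 1 - a < visits G x (- A) N / N"
        using that A by (intro lower) auto
      then show ?thesis using eventually_gt_at_top[of 0]
      proof eventually_elim
        case (elim N)
        then show ?case unfolding visits_Compl by (simp add: diff_divide_distrib)
      qed
    qed
  qed
  then show "normal x" using R by (auto simp: normal_def)
qed

end

section \<open>Visit frequencies for a measure preserving map\<close>

lemma visits_add: "visits f x A (m + n) = visits f x A m + visits f ((f ^^ m) x) A n"
proof -
  have "real (visits f x A (m + n)) = real (visits f x A m) + real (visits f ((f ^^ m) x) A n)"
  proof (induction n)
    case (Suc n)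
    have "(f ^^ (m + n)) x = (f ^^ n) ((f ^^ m) x)" by (metis add.commute comp_apply funpow_add)
    then show ?case using Suc by (simp add: visits_eq_sum)
  qed (simp add: visits_eq_sum)
  then show ?thesis by linarith
qed

lemma visits_Suc: "visits f x A (Suc n) = (if x \<in> A then 1 else 0) + visits f (f x) A n"
proof -
  have "real (visits f x A 1) = real (if x \<in> A then 1 else 0)" by (simp add: visits_eq_sum indicator_def)
  then have "visits f x A 1 = (if x \<in> A then 1 else 0)" by linarith
  then show ?thesis using visits_add[of f x A 1 n] by simp
qed

context prob_space
begin

lemma measurable_visits:
  assumes "T \<in> measurable M M" "A \<in> sets M"
  shows "(\<lambda>x. real (visits T x A n)) \<in> borel_measurable M"
proof -
  have [measurable]: "A \<in> sets M" "(T ^^ m) \<in> measurable M M" for m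
    using assms by (auto intro: measurable_compose_n)
  show ?thesis unfolding visits_eq_sum by measurable
qed

lemma integral_visits:
  assumes T: "T \<in> measurable M M" "distr M M T = M" and A: "A \<in> sets M"
  shows "(\<integral>x. real (visits T x A n) \<partial>M) = n * measure M A"
proof -
  have Tm: "(T ^^ m) \<in> measurable M M" for m using T by (intro measurable_compose_n)
  have d: "distr M M (T ^^ m) = M" for m
  proof (induction m)
    case (Suc m)
    have "distr M M (T \<circ> (T ^^ m)) = distr (distr M M (T ^^ m)) M T"
      using T Tm by (intro distr_distr[symmetric])
    then show ?case using Suc T unfolding funpow.simps by metis
  qed (simp add: distr_id2 id_def)
  have "(\<integral>x. indicator A ((T ^^ m) x) \<partial>M) = measure M A" for m
  proof -
    have "(\<integral>x. indicator A ((T ^^ m) x) \<partial>M) = (\<integral>x. (indicator A x :: real) \<partial>distr M M (T ^^ m))"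
      by (rule integral_distr[OF Tm, symmetric]) (use A in simp)
    also have "\<dots> = measure M A" using A sets.sets_into_space[OF A] by (simp add: d Int_absorb2)
    finally show ?thesis .
  qed
  moreover have "integrable M (\<lambda>x. indicator A ((T ^^ m) x) :: real)" for m
    using Tm A by (intro integrable_const_bound[where B=1]) (auto simp: indicator_def intro!: AE_I2)
  ultimately show ?thesis unfolding visits_eq_sum by simp
qed

text \<open>Katznelson and Weiss: away from the small set \<open>B L\<close> of points that have to wait longer than
  \<open>L\<close> for a good average, an orbit splits into blocks with good averages.\<close>

lemma le_measure_of_visits:
  assumes T: "T \<in> measurable M M" "distr M M T = M" and A: "A \<in> sets M"
    and ae: "AE x in M. \<exists>n\<ge>1. c * real n \<le> real (visits T x A n)"
  shows "c \<le> measure M A"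
proof (cases "c \<le> 0")
  case True then show ?thesis by (meson measure_nonneg order_trans)
next
  case False
  define B where "B L = {x \<in> space M. \<forall>n\<in>{1..L}. real (visits T x A n) < c * n}" for L :: nat
  \<comment> \<open>Needed below, where a single step taken inside \<open>B L\<close> counts as one
    visit and must pay for \<open>c\<close>.\<close>
  have c1: "c \<le> 1"
  proof -
    have "\<exists>x n. 1 \<le> n \<and> c * real n \<le> real (visits T x A n)"
    proof (rule ccontr)
      assume "\<not> ?thesis"
      then have "AE x in M. \<not> (\<exists>n\<ge>1. c * real n \<le> real (visits T x A n))" by blast
      then show False by (rule AE_contr[OF ae])
    qed
    then obtain x n where n: "1 \<le> n" "c * real n \<le> real (visits T x A n)" by blast
    then have "c * real n \<le> 1 * real n" using visits_le[of T x A n] by linarith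
    then show ?thesis by (rule mult_right_le_imp_le) (use n in simp)
  qed
  have B: "B L \<in> sets M" for L
    unfolding B_def using measurable_visits[OF T(1) A] by (intro sets.sets_Collect_finite_All) auto
  have "(\<lambda>L. measure M (B L)) \<longlonglongrightarrow> measure M (\<Inter>L. B L)"
  proof (rule finite_Lim_measure_decseq)
    show "range B \<subseteq> sets M" using B by auto
    show "decseq B" by (rule decseq_SucI) (auto simp: B_def)
  qed
  moreover have "measure M (\<Inter>L. B L) = 0"
  proof -
    have "AE x in M. x \<notin> (\<Inter>L. B L)"
      using ae by eventually_elim (force simp: B_def not_less)
    moreover have "(\<Inter>L. B L) \<in> sets M" using B by (intro sets.countable_INT) auto
    ultimately show ?thesis by (simp only: AE_iff_null_sets[symmetric] measure_eq_0_null_sets)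
  qed
  ultimately have lim: "(\<lambda>L. measure M (B L)) \<longlonglongrightarrow> 0" by simp
  have "c \<le> measure M A + measure M (B L)" for L
  proof -
    let ?C = "A \<union> B L"
    have C: "?C \<in> sets M" using A B by auto
    \<comment> \<open>By strong induction on \<open>N\<close>: from a point of \<open>B L\<close> a
      single step is split off, from any other point a good block of length at most
      \<open>L\<close>. Only a remainder of at most \<open>L\<close> steps is lost.\<close>
    have blocks: "c * (real N - real L) \<le> real (visits T x ?C N)" if "x \<in> space M" for N x
      using that
    proof (induction N arbitrary: x rule: less_induct)
      case (less N)
      show ?case
      proof (cases "N \<le> L")
        case True
        then have "c * (real N - real L) \<le> 0" using False by (intro mult_nonneg_nonpos) auto
        then show ?thesis by (meson of_nat_0_le_iff order_trans)
      next
        case NL: False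
        show ?thesis
        proof (cases "x \<in> B L")
          case True
          have "N = Suc (N - 1)" using NL by simp
          then have "real (visits T x ?C N) = 1 + real (visits T (T x) ?C (N - 1))"
            using visits_Suc[of T x ?C "N - 1"] True by simp
          moreover have "c * (real (N - 1) - real L) \<le> real (visits T (T x) ?C (N - 1))"
            using less NL measurable_space[OF T(1)] by (intro less) auto
          ultimately show ?thesis using c1 NL by (simp add: algebra_simps of_nat_diff)
        next
          case notB: False
          then obtain n where n: "1 \<le> n" "n \<le> L" "c * real n \<le> real (visits T x A n)"
            using less.prems by (auto simp: B_def not_less)
          have "N = n + (N - n)" using n NL by simp
          then have "real (visits T x ?C N) = real (visits T x ?C n) + real (visits T ((T ^^ n) x) ?C (N - n))"
            using visits_add[of T x ?C n "N - n"] by simp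
          moreover have "c * (real (N - n) - real L) \<le> real (visits T ((T ^^ n) x) ?C (N - n))"
            using less.prems n NL measurable_space[OF measurable_compose_n[OF T(1)]] by (intro less) auto
          moreover have "real (visits T x A n) \<le> real (visits T x ?C n)"
            using visits_mono[of A ?C] by auto
          ultimately show ?thesis using n NL by (simp add: algebra_simps of_nat_diff)
        qed
      qed
    qed
    have "c * (real N - real L) \<le> N * measure M ?C" for N
    proof -
      have "c * (real N - real L) = (\<integral>x. c * (real N - real L) \<partial>M)" by (simp add: prob_space)
      also have "\<dots> \<le> (\<integral>x. real (visits T x ?C N) \<partial>M)"
      proof (rule integral_mono)
        show "integrable M (\<lambda>x. real (visits T x ?C N))"
          using measurable_visits[OF T(1) C, of N] visits_le[of T _ ?C N]
          by (intro integrable_const_bound[where B="real N"]) auto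
      qed (use blocks in auto)
      also have "\<dots> = N * measure M ?C" by (rule integral_visits[OF T C])
      finally show ?thesis .
    qed
    then have "\<forall>N\<ge>1. c - c * real L * inverse (real N) \<le> measure M ?C"
      by (auto simp: field_simps)
    then have "\<forall>\<^sub>F N in sequentially. c - c * real L * inverse (real N) \<le> measure M ?C"
      using eventually_sequentially by blast
    moreover have "(\<lambda>N. c - c * real L * inverse (real N)) \<longlonglongrightarrow> c - c * real L * 0"
      by (intro tendsto_intros lim_inverse_n)
    ultimately have "c \<le> measure M ?C" using tendsto_upperbound[OF _ _ sequentially_bot] by fastforce
    also have "\<dots> \<le> measure M A + measure M (B L)" using A B by (intro measure_Un_le)
    finally show ?thesis .
  qed
  moreover have "(\<lambda>L. measure M A + measure M (B L)) \<longlonglongrightarrow> measure M A + 0"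
    by (intro tendsto_intros lim)
  ultimately show ?thesis using LIMSEQ_le_const by fastforce
qed

end

section \<open>Ergodicity of the Gauss map\<close>

interpretation gauss: alpha_cf 1 by unfold_locales simp_all

text \<open>The finite continued fraction with digits \<open>bs\<close> and tail \<open>t\<close>,
  that is, an inverse branch of an iterate of the Gauss map.\<close>

fun branch :: "int list \<Rightarrow> real \<Rightarrow> real" where
  "branch [] t = t"
| "branch (b # bs) t = 1 / (of_int b + branch bs t)"

lemma branch_append: "branch (bs @ cs) t = branch bs (branch cs t)"
  by (induction bs) auto

text \<open>The coefficients are those of consecutive convergents, obtained from the usual
  recurrence when a digit is appended at the end. The determinant is \<plusminus>1, and
  \<open>q' \<le> q\<close> is what bounds the distortion.\<close>

lemma branch_moebius:
  assumes "\<forall>b\<in>set bs. 1 \<le> b"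
  shows "\<exists>p p' q q'. 0 \<le> q' \<and> q' \<le> q \<and> 1 \<le> q \<and> \<bar>p' * q - p * q'\<bar> = 1 \<and>
    (\<forall>t\<in>{0..1}. branch bs t = (p + p' * t) / (q + q' * t))"
  using assms
proof (induction bs rule: rev_induct)
  case Nil
  show ?case by (rule exI[of _ 0], rule exI[of _ 1], rule exI[of _ 1], rule exI[of _ 0]) simp
next
  case (snoc b bs)
  then obtain p p' q q' where h: "0 \<le> q'" "q' \<le> q" "1 \<le> q" "\<bar>p' * q - p * q'\<bar> = 1"
    "\<And>t. t \<in> {0..1} \<Longrightarrow> branch bs t = (p + p' * t) / (q + q' * t)" by auto
  define b' where "b' = real_of_int b"
  have b: "1 \<le> b'" using snoc by (simp add: b'_def)
  have "branch (bs @ [b]) t = ((p * b' + p') + p * t) / ((q * b' + q') + q * t)" if t: "t \<in> {0..1}" for t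
  proof -
    have bt: "0 < b' + t" using b t by auto
    have "branch (bs @ [b]) t = branch bs (1 / (b' + t))" by (simp add: branch_append b'_def)
    also have "\<dots> = (p + p' * (1 / (b' + t))) / (q + q' * (1 / (b' + t)))"
      using b t by (intro h) (auto simp: field_simps)
    also have "\<dots> = ((p + p' * (1 / (b' + t))) * (b' + t)) / ((q + q' * (1 / (b' + t))) * (b' + t))"
      using bt by simp
    also have "(p + p' * (1 / (b' + t))) * (b' + t) = (p * b' + p') + p * t" using bt by (simp add: field_simps)
    also have "(q + q' * (1 / (b' + t))) * (b' + t) = (q * b' + q') + q * t" using bt by (simp add: field_simps)
    finally show ?thesis .
  qed
  moreover have "q * 1 \<le> q * b'" using b h(3) by (intro mult_left_mono) auto
  then have "0 \<le> q" "q \<le> q * b' + q'" "1 \<le> q * b' + q'" using h(1,3) by linarith+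
  moreover have "\<bar>p * (q * b' + q') - (p * b' + p') * q\<bar> = 1"
    using h(4) by (simp add: algebra_simps abs_minus_commute)
  ultimately show ?case by blast
qed

text \<open>The derivative has modulus \<open>1 / (q + q' * t)\<^sup>2\<close>, and the base lies
  between \<open>q\<close> and \<open>2 * q\<close>. Hence the modulus lies between
  \<open>k = 1 / (4 * q\<^sup>2)\<close> and \<open>4 * k\<close>, with the same \<open>k\<close>
  for all sets \<open>S\<close>.\<close>

lemma branch_image_measure:
  assumes "\<forall>b\<in>set bs. 1 \<le> b"
  shows "\<exists>k. \<forall>S\<in>sets borel. S \<subseteq> {0..1} \<longrightarrow> branch bs ` S \<in> lmeasurable \<and>
      k * measure lborel S \<le> measure lebesgue (branch bs ` S) \<and>
      measure lebesgue (branch bs ` S) \<le> 4 * k * measure lborel S"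
proof -
  obtain p p' q q' where h: "0 \<le> q'" "q' \<le> q" "1 \<le> q" "\<bar>p' * q - p * q'\<bar> = 1"
    "\<And>t. t \<in> {0..1} \<Longrightarrow> branch bs t = (p + p' * t) / (q + q' * t)"
    using branch_moebius[OF assms] by blast
  define g where "g t = (p + p' * t) / (q + q' * t)" for t
  define g' where "g' t = (p' * q - p * q') / (q + q' * t)\<^sup>2" for t
  define k where "k = 1 / (4 * q\<^sup>2)"
  have q: "q \<le> q + q' * t" "q + q' * t \<le> 2 * q" if "t \<in> {0..1}" for t
  proof -
    have "0 \<le> q' * t" "q' * t \<le> q' * 1" using that h(1) by (auto intro!: mult_left_mono simp del: mult_1_right)
    then show "q \<le> q + q' * t" "q + q' * t \<le> 2 * q" using h by linarith+
  qed
  have der: "(g has_field_derivative g' t) (at t within S)" if "t \<in> {0..1}" for t S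
  proof -
    have "q + q' * t \<noteq> 0" using q[OF that] h by linarith
    then show ?thesis unfolding g_def[abs_def] g'_def
      by (auto intro!: derivative_eq_intros simp: power2_eq_square field_simps)
  qed
  have inj: "inj_on g {0..1}"
  proof (rule inj_onI)
    fix s t assume st: "s \<in> {0..1}" "t \<in> {0..1}" "g s = g t"
    have "q + q' * t \<noteq> 0" "q + q' * s \<noteq> 0" using q[OF st(1)] q[OF st(2)] h by linarith+
    then have "(p + p' * s) * (q + q' * t) = (p + p' * t) * (q + q' * s)"
      using st(3) by (simp add: g_def frac_eq_eq)
    then have "(p' * q - p * q') * (s - t) = 0" by (simp add: algebra_simps)
    then show "s = t" using h(4) by auto
  qed
  have abs_g': "k \<le> \<bar>g' t\<bar>" "\<bar>g' t\<bar> \<le> 4 * k" if "t \<in> {0..1}" for t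
  proof -
    have e: "\<bar>g' t\<bar> = 1 / (q + q' * t)\<^sup>2" unfolding g'_def by (simp add: h(4) abs_divide)
    have "q\<^sup>2 \<le> (q + q' * t)\<^sup>2" "(q + q' * t)\<^sup>2 \<le> (2 * q)\<^sup>2" using q[OF that] h(3) by (intro power_mono; linarith)+
    moreover have "0 < q\<^sup>2" using h by auto
    ultimately show "k \<le> \<bar>g' t\<bar>" "\<bar>g' t\<bar> \<le> 4 * k"
      unfolding e k_def by (auto intro!: divide_left_mono mult_pos_pos simp: power_mult_distrib)
  qed
  have "branch bs ` S \<in> lmeasurable \<and> k * measure lborel S \<le> measure lebesgue (branch bs ` S) \<and>
      measure lebesgue (branch bs ` S) \<le> 4 * k * measure lborel S"
    if S: "S \<in> sets borel" "S \<subseteq> {0..1}" for S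
  proof -
    have Sl: "S \<in> sets lebesgue" using S by auto
    have Sm: "S \<in> lmeasurable" using S(2) Sl by (meson bounded_closed_interval bounded_set_imp_lmeasurable bounded_subset)
    have im: "branch bs ` S = g ` S" using h(5) S(2) by (intro image_cong) (auto simp: g_def)
    have mS: "measure lebesgue S = measure lborel S" using S by simp
    have cont: "continuous_on {0..1} g'"
    proof -
      have "(q + q' * t)\<^sup>2 \<noteq> 0" if "t \<in> {0..1}" for t using q(1)[OF that] h(3) by auto
      then show ?thesis
        unfolding g'_def[abs_def] by (intro continuous_on_divide continuous_intros) blast
    qed
    have m: "(\<lambda>t. \<bar>g' t\<bar>) \<in> borel_measurable (lebesgue_on S)"
      using continuous_imp_measurable_on_sets_lebesgue[OF continuous_on_subset[OF cont S(2)] Sl]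
      by (rule borel_measurable_abs)
    have ab: "(\<lambda>t. \<bar>g' t\<bar> * 1) absolutely_integrable_on S"
      using m Sl abs_g' S(2)
      by (intro measurable_bounded_by_integrable_imp_absolutely_integrable[where g="\<lambda>_. 4 * k"])
        (auto intro: integrable_on_const[OF Sm])
    have cv: "(\<lambda>_. 1::real) absolutely_integrable_on g ` S \<and> integral (g ` S) (\<lambda>_. 1) = integral S (\<lambda>t. \<bar>g' t\<bar> * 1)"
      using has_absolute_integral_change_of_variables_1'[OF Sl der inj_on_subset[OF inj S(2)], of "\<lambda>_. 1" "integral S (\<lambda>t. \<bar>g' t\<bar> * 1)"]
        ab S(2) by blast
    have lm: "g ` S \<in> lmeasurable"
      using cv by (simp add: lmeasurable_iff_integrable_on absolutely_integrable_on_def)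
    have mg: "measure lebesgue (g ` S) = integral S (\<lambda>t. \<bar>g' t\<bar> * 1)"
      using cv lmeasure_integral[OF lm] by simp
    have cst: "integral S (\<lambda>_. c) = c * measure lebesgue S" for c :: real
      using lmeasure_integral[OF Sm] integral_mult_right[of S c "\<lambda>_. 1"] by simp
    have ci: "(\<lambda>_. c) integrable_on S" for c :: real by (rule integrable_on_const[OF Sm])
    have "k * measure lebesgue S \<le> measure lebesgue (g ` S)"
      unfolding mg cst[symmetric] using abs_g' S(2) ab
      by (intro integral_le ci) (auto simp: absolutely_integrable_on_def)
    moreover have "measure lebesgue (g ` S) \<le> 4 * k * measure lebesgue S"
      unfolding mg cst[symmetric] using abs_g' S(2) ab
      by (intro integral_le ci) (auto simp: absolutely_integrable_on_def)
    ultimately show ?thesis using lm im mS by auto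
  qed
  then show ?thesis by (intro exI[of _ k]) simp
qed

lemma gauss_I: "x \<in> I_alpha 1 \<longleftrightarrow> 0 \<le> x \<and> x < 1"
  by (auto simp: I_alpha_def)

lemma branch_in_cylinder:
  assumes "\<forall>b\<in>set bs. 1 \<le> b" "t \<in> I_alpha 1" "t \<notin> \<rat>"
  shows "branch bs t \<in> cylinder 1 bs \<and> branch bs t \<notin> \<rat> \<and> (G_alpha 1 ^^ length bs) (branch bs t) = t"
  using assms
proof (induction bs)
  case Nil then show ?case by (simp add: cylinder_Nil)
next
  case (Cons b bs)
  define s where "s = branch bs t"
  have s: "s \<in> cylinder 1 bs" "s \<notin> \<rat>" "(G_alpha 1 ^^ length bs) s = t"
    using Cons by (auto simp: s_def)
  have "s \<in> I_alpha 1" using s gauss.cylinder_subset by blast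
  moreover have "s \<noteq> 0" using s(2) by auto
  ultimately have s01: "0 < s" "s < 1" by (auto simp: gauss_I)
  have b: "1 \<le> real_of_int b" using Cons.prems by simp
  define x where "x = 1 / (b + s)"
  have x: "0 < x" "x < 1" using b s01 by (auto simp: x_def field_simps)
  have rx: "1 / \<bar>x\<bar> = b + s" using x b s01 by (simp add: x_def)
  have fl: "\<lfloor>1 / \<bar>x\<bar> + 1 - 1\<rfloor> = b" unfolding rx using s01 by (simp add: floor_eq_iff)
  have Gx: "G_alpha 1 x = s" unfolding G_alpha_def fl using x rx by simp
  have "digit 1 x = b" unfolding digit_def fl using x by simp
  then have "x \<in> cylinder 1 (b # bs)" using x s Gx by (simp add: gauss.cylinder_Cons gauss_I)
  moreover have "x \<notin> \<rat>"
  proof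
    assume "x \<in> \<rat>"
    then have "1 / x - of_int b \<in> \<rat>" by simp
    moreover have "1 / x - of_int b = s" using rx x by simp
    ultimately show False using s by simp
  qed
  moreover have "(G_alpha 1 ^^ length (b # bs)) x = t" using Gx s(3) by (simp add: funpow_swap1)
  ultimately show ?case by (simp add: x_def s_def)
qed

lemma cylinder_eq_branch:
  assumes "x \<in> cylinder 1 bs" "x \<notin> \<rat>"
  shows "(\<forall>b\<in>set bs. 1 \<le> b) \<and> x = branch bs ((G_alpha 1 ^^ length bs) x)"
  using assms
proof (induction bs arbitrary: x)
  case (Cons b bs)
  then have d: "digit 1 x = b" and c: "G_alpha 1 x \<in> cylinder 1 bs" and I: "x \<in> I_alpha 1"
    by (auto simp: gauss.cylinder_Cons)
  have "x \<noteq> 0" using Cons.prems by auto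
  then have x: "0 < x" using I by (auto simp: gauss_I)
  have b: "b = \<lfloor>1 / \<bar>x\<bar> + 1 - 1\<rfloor>" using d x by (simp add: digit_def)
  have "1 \<le> b" using gauss.quotient_ge_1[OF I \<open>x \<noteq> 0\<close>] b by simp
  moreover have IH: "(\<forall>b\<in>set bs. 1 \<le> b) \<and> G_alpha 1 x = branch bs ((G_alpha 1 ^^ length bs) (G_alpha 1 x))"
    using gauss.G_irrational[OF Cons.prems(2)] c by (intro Cons.IH)
  moreover have "x = 1 / (b + G_alpha 1 x)"
  proof -
    have "G_alpha 1 x = 1 / x - b" using x b by (simp add: G_alpha_def)
    then show ?thesis using x by simp
  qed
  ultimately show ?case by (simp add: funpow_swap1)
qed simp

lemma measure_Diff_Rats:
  fixes A :: "real set"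
  assumes "A \<in> sets borel" shows "measure lborel (A - \<rat>) = measure lborel A"
  using countable_imp_null_set_lborel[OF countable_rat] assms by (intro measure_Diff_null_set) auto

text \<open>Renyi's inequality: a cylinder carries a fixed share of the preimage of
  \<open>E\<close>. It combines the lower distortion bound for \<open>E\<close> with the upper bound
  for the whole interval, where the unknown scale \<open>k\<close> cancels up to the factor
  4.\<close>

lemma gauss_renyi:
  assumes E: "E \<in> sets borel" "E \<subseteq> I_alpha 1"
  shows "measure lborel E * measure lborel (cylinder 1 bs) / 4
    \<le> measure lborel (cylinder 1 bs \<inter> (G_alpha 1 ^^ length bs) -` E)"
proof (cases "\<forall>b\<in>set bs. 1 \<le> b")
  case False
  \<comment> \<open>An irrational point has positive Gauss digits only, so this cylinder is null and
    the left side vanishes.\<close>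
  then have "cylinder 1 bs - \<rat> = {}" using cylinder_eq_branch by blast
  then have "measure lborel (cylinder 1 bs) = 0"
    using measure_Diff_Rats[OF gauss.cylinder_borel] by (metis measure_empty)
  then show ?thesis by simp
next
  case True
  obtain k where k: "\<forall>S\<in>sets borel. S \<subseteq> {0..1} \<longrightarrow> branch bs ` S \<in> lmeasurable \<and>
      k * measure lborel S \<le> measure lebesgue (branch bs ` S) \<and>
      measure lebesgue (branch bs ` S) \<le> 4 * k * measure lborel S"
    using branch_image_measure[OF True] by (rule exE)
  have im: "branch bs ` (A - \<rat>) = (cylinder 1 bs \<inter> (G_alpha 1 ^^ length bs) -` A) - \<rat>" if "A \<subseteq> I_alpha 1" for A
  proof
    show "branch bs ` (A - \<rat>) \<subseteq> (cylinder 1 bs \<inter> (G_alpha 1 ^^ length bs) -` A) - \<rat>"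
      using branch_in_cylinder[OF True] that by (auto simp: subset_iff)
    show "(cylinder 1 bs \<inter> (G_alpha 1 ^^ length bs) -` A) - \<rat> \<subseteq> branch bs ` (A - \<rat>)"
    proof
      fix x assume x: "x \<in> (cylinder 1 bs \<inter> (G_alpha 1 ^^ length bs) -` A) - \<rat>"
      then have "x = branch bs ((G_alpha 1 ^^ length bs) x)" "(G_alpha 1 ^^ length bs) x \<in> A - \<rat>"
        using cylinder_eq_branch gauss.funpow_irrational by auto
      then show "x \<in> branch bs ` (A - \<rat>)" by (rule image_eqI)
    qed
  qed
  have meas: "cylinder 1 bs \<inter> (G_alpha 1 ^^ length bs) -` A \<in> sets borel" if "A \<in> sets borel" for A
  proof -
    have "(G_alpha 1 ^^ length bs) \<in> borel_measurable borel"
      by (rule measurable_compose_n[OF gauss.G_borel])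
    then show ?thesis using that gauss.cylinder_borel measurable_sets[of _ borel borel A] by auto
  qed
  have R: "A - \<rat> \<in> sets borel" if "A \<in> sets borel" for A :: "real set"
    by (rule sets.Diff[OF that sets.countable[OF _ countable_rat]]) simp
  have sub: "A - \<rat> \<subseteq> {0..1}" if "A \<subseteq> I_alpha 1" for A using that by (force simp: gauss_I)
  have mm: "measure lebesgue (branch bs ` (A - \<rat>)) = measure lborel (cylinder 1 bs \<inter> (G_alpha 1 ^^ length bs) -` A)"
    if "A \<subseteq> I_alpha 1" "A \<in> sets borel" for A
    unfolding im[OF that(1)] using measure_Diff_Rats[OF meas[OF that(2)]] R[OF meas[OF that(2)]] by simp
  have "cylinder 1 bs \<inter> (G_alpha 1 ^^ length bs) -` I_alpha 1 = cylinder 1 bs"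
    using gauss.funpow_in_I gauss.cylinder_subset by blast
  then have "measure lborel (cylinder 1 bs) \<le> 4 * k * measure lborel (I_alpha 1 - \<rat>)"
    using k[rule_format, OF R[OF gauss.I_borel] sub[OF order_refl]] mm[OF order_refl gauss.I_borel] by simp
  also have "measure lborel (I_alpha 1 - \<rat>) = 1"
    using measure_Diff_Rats[OF gauss.I_borel] by (simp add: I_alpha_def)
  finally have "measure lborel (cylinder 1 bs) \<le> 4 * k" by simp
  then have "measure lborel E * measure lborel (cylinder 1 bs) \<le> measure lborel E * (4 * k)"
    by (intro mult_left_mono) auto
  moreover have "k * measure lborel E \<le> measure lborel (cylinder 1 bs \<inter> (G_alpha 1 ^^ length bs) -` E)"
    using k[rule_format, OF R[OF E(1)] sub[OF E(2)]] mm[OF E(2,1)] measure_Diff_Rats[OF E(1)] by simp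
  ultimately show ?thesis by (simp add: algebra_simps)
qed

section \<open>A density argument on cylinders, and ergodicity\<close>

lemma fmeasurable_subset_I1: "A \<in> sets borel \<Longrightarrow> A \<subseteq> I_alpha 1 \<Longrightarrow> A \<in> fmeasurable lborel"
  by (rule fmeasurableI2[of "I_alpha 1"]) (auto simp: I_alpha_def fmeasurable_def)

text \<open>Replaces the Lebesgue density theorem: an open set that exceeds \<open>B\<close> only
  slightly is nearly filled by cylinders, and \<open>B\<close> misses a share \<open>c\<close> of
  each of them.\<close>

lemma gauss_density:
  assumes B: "B \<in> sets borel" "B \<subseteq> I_alpha 1" and "0 < c"
    and cyl: "\<And>bs. measure lborel (B \<inter> cylinder 1 bs) \<le> (1 - c) * measure lborel (cylinder 1 bs)"
  shows "measure lborel B = 0"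
proof (rule ccontr)
  let ?m = "measure lborel" and ?I = "I_alpha 1"
  assume "?m B \<noteq> 0"
  then have Bpos: "0 < ?m B" by (simp add: zero_less_measure_iff)
  have c1: "c \<le> 1"
  proof (rule ccontr)
    assume "\<not> c \<le> 1"
    moreover have "?m (cylinder 1 []) = 1" by (simp add: cylinder_Nil I_alpha_def)
    ultimately have "?m (B \<inter> cylinder 1 []) < 0" using cyl[of "[]"] by (metis diff_less_0_iff_less linorder_not_le mult.right_neutral order_le_less_trans)
    then show False using measure_nonneg[of lborel "B \<inter> cylinder 1 []"] by linarith
  qed
  \<comment> \<open>One error \<open>e\<close> comes from the excess of \<open>U\<close> over
    \<open>B\<close>, another from the part of \<open>U\<close> left uncovered; three of them make
    up \<open>c * ?m B\<close>.\<close>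
  define e where "e = c * ?m B / 3"
  have e: "0 < e" using Bpos \<open>0 < c\<close> by (simp add: e_def)
  obtain U where U: "open U" "B \<subseteq> U" "emeasure lborel (U - B) < ennreal e"
    using outer_regular_lborel[OF B(1) e] by blast
  define N where "N = restrict_space lborel ?I"
  have mN: "measure N A = ?m A" if "A \<subseteq> ?I" for A
    unfolding N_def using gauss.I_borel that by (intro measure_restrict_space) auto
  have "finite_measure N"
    by (rule finite_measureI) (simp add: N_def space_restrict_space emeasure_restrict_space I_alpha_def)
  moreover have "measure N (\<rat> \<inter> ?I) = 0"
    unfolding mN[OF Int_lower2]
    by (rule measure_eq_0_null_sets[OF countable_imp_null_set_lborel[OF countable_Int1[OF countable_rat]]])
  ultimately obtain n P where P: "finite P"
    "\<And>bs. bs \<in> P \<Longrightarrow> length bs = n \<and> 0 \<notin> set bs \<and> cylinder 1 bs \<subseteq> U"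
    "measure N (U \<inter> ?I) < measure N (\<Union>bs\<in>P. cylinder 1 bs) + e"
    using gauss.cylinders_exhaust_open[of N U e] U e unfolding N_def by metis
  let ?V = "\<Union>bs\<in>P. cylinder 1 bs"
  have VI: "?V \<subseteq> ?I" using gauss.cylinder_subset by blast
  have Vb: "?V \<in> sets borel" using P gauss.cylinder_borel by (intro sets.finite_UN) auto
  have UIb: "U \<inter> ?I \<in> sets borel" using U gauss.I_borel by auto
  note fm = fmeasurable_subset_I1
  have dis: "cylinder 1 b \<inter> cylinder 1 d = {}" if "b \<in> P" "d \<in> P" "b \<noteq> d" for b d
    using P(2) that by (metis gauss.cylinder_disjoint)
  have sumV: "?m (A \<inter> ?V) = (\<Sum>bs\<in>P. ?m (A \<inter> cylinder 1 bs))" if "A \<in> sets borel" for A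
  proof -
    have "A \<inter> cylinder 1 bs \<in> fmeasurable lborel" for bs
      using that gauss.cylinder_borel gauss.cylinder_subset by (intro fm) auto
    moreover have "A \<inter> ?V = (\<Union>bs\<in>P. A \<inter> cylinder 1 bs)" by auto
    ultimately show ?thesis using P(1) dis
      by (simp only:) (intro measure_finite_Union; auto simp: disjoint_family_on_def fmeasurable_def top.not_eq_extremum)
  qed
  have "?m (B \<inter> ?V) \<le> (\<Sum>bs\<in>P. (1 - c) * ?m (cylinder 1 bs))"
    unfolding sumV[OF B(1)] by (intro sum_mono cyl)
  also have "\<dots> = (1 - c) * ?m ?V" using sumV[of UNIV] by (simp add: sum_distrib_left)
  also have "\<dots> \<le> (1 - c) * (?m B + e)"
  proof (intro mult_left_mono)
    have "?m ?V \<le> ?m (U \<inter> ?I)"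
      using P(2) VI by (intro measure_mono_fmeasurable Vb fm UIb) (auto simp: Vb)
    also have "\<dots> \<le> ?m (B \<union> (U \<inter> ?I - B))"
      using B UIb U by (intro measure_mono_fmeasurable fm) auto
    also have "\<dots> \<le> ?m B + ?m (U \<inter> ?I - B)" using B UIb by (intro measure_Un_le) auto
    also have "?m (U \<inter> ?I - B) \<le> e"
    proof -
      have "emeasure lborel (U \<inter> ?I - B) \<le> emeasure lborel (U - B)" using U B by (intro emeasure_mono) auto
      also have "\<dots> \<le> ennreal e" using U by simp
      finally show ?thesis using e by (simp add: measure_def enn2real_leI)
    qed
    finally show "?m ?V \<le> ?m B + e" by simp
  qed (use c1 in simp)
  finally have 1: "?m (B \<inter> ?V) \<le> (1 - c) * (?m B + e)" .
  have "?m B \<le> ?m ((B \<inter> ?V) \<union> (U \<inter> ?I - ?V))"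
    using B UIb Vb U VI by (intro measure_mono_fmeasurable fm) auto
  also have "\<dots> \<le> ?m (B \<inter> ?V) + ?m (U \<inter> ?I - ?V)" using B UIb Vb by (intro measure_Un_le) auto
  also have "?m (U \<inter> ?I - ?V) = ?m (U \<inter> ?I) - ?m ?V"
    using P(2) VI UIb Vb fm[OF UIb] by (intro measure_Diff) (auto simp: fmeasurable_def top.not_eq_extremum)
  also have "\<dots> \<le> e" using P(3) VI by (simp add: mN)
  finally have "?m B \<le> (1 - c) * (?m B + e) + e" using 1 by linarith
  then have "c * ?m B \<le> 2 * e - c * e" by (simp add: algebra_simps)
  also have "\<dots> < 3 * e" using e \<open>0 < c\<close> by (simp add: algebra_simps) (smt (verit) mult_pos_pos)
  finally show False by (simp add: e_def)
qed

text \<open>By \<open>gauss_renyi\<close> a share of at least \<open>a / 4\<close> of every cylinder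
  is mapped into \<open>[0, a)\<close> by the iterate of the cylinder's length, so the avoiding set
  meets no cylinder in more than the rest.\<close>

lemma gauss_avoid_null:
  assumes "0 < a" "a \<le> 1"
  shows "measure lborel {x \<in> I_alpha 1. \<forall>k. a \<le> (G_alpha 1 ^^ k) x} = 0" (is "measure _ ?T = 0")
proof (rule gauss_density)
  have m: "(G_alpha 1 ^^ n) \<in> borel_measurable borel" for n by (rule measurable_compose_n[OF gauss.G_borel])
  have "?T = I_alpha 1 \<inter> (\<Inter>k. (G_alpha 1 ^^ k) -` {a..})" by auto
  moreover have "(G_alpha 1 ^^ k) -` {a..} \<in> sets borel" for k using measurable_sets[OF m[of k], of "{a..}"] by auto
  ultimately show "?T \<in> sets borel" using gauss.I_borel by auto
  show "?T \<subseteq> I_alpha 1" by auto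
  show "0 < a / 4" using assms by simp
  fix bs
  let ?c = "cylinder 1 bs" and ?F = "(G_alpha 1 ^^ length bs) -` {0..<a}"
  have F: "?F \<in> sets borel" using measurable_sets[OF m, of "{0..<a}"] by auto
  have "a * measure lborel ?c / 4 \<le> measure lborel (?c \<inter> ?F)"
    using gauss_renyi[of "{0..<a}" bs] assms by (auto simp: I_alpha_def)
  moreover have "measure lborel (?T \<inter> ?c) \<le> measure lborel (?c - ?c \<inter> ?F)"
    using gauss.cylinder_borel F \<open>?T \<in> sets borel\<close> gauss.cylinder_subset
    by (intro measure_mono_fmeasurable fmeasurable_subset_I1) (auto, metis not_less)
  moreover have "measure lborel (?c - ?c \<inter> ?F) = measure lborel ?c - measure lborel (?c \<inter> ?F)"
    using fmeasurable_subset_I1[OF gauss.cylinder_borel gauss.cylinder_subset] F gauss.cylinder_borel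
    by (intro measure_Diff) (auto simp: fmeasurable_def top.not_eq_extremum)
  ultimately show "measure lborel (?T \<inter> ?c) \<le> (1 - a / 4) * measure lborel ?c" by (simp add: algebra_simps)
qed

text \<open>For invariant \<open>E\<close> the preimage in \<open>gauss_renyi\<close> is
  \<open>E\<close> itself. A set \<open>E\<close> of positive measure thus fills at least the share
  \<open>measure lborel E / 4\<close> of every cylinder, and \<open>gauss_density\<close> makes the
  complement null.\<close>

lemma gauss_ergodic:
  assumes E: "E \<in> sets borel" "E \<subseteq> I_alpha 1" and inv: "\<And>x. x \<in> I_alpha 1 \<Longrightarrow> G_alpha 1 x \<in> E \<longleftrightarrow> x \<in> E"
  shows "measure lborel E = 0 \<or> measure lborel (I_alpha 1 - E) = 0"
proof (rule disjCI)
  assume "measure lborel (I_alpha 1 - E) \<noteq> 0"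
  show "measure lborel E = 0"
  proof (rule ccontr)
    assume n: "measure lborel E \<noteq> 0"
    have invn: "(G_alpha 1 ^^ n) x \<in> E \<longleftrightarrow> x \<in> E" if "x \<in> I_alpha 1" for n x
      using that by (induction n) (auto simp: inv gauss.funpow_in_I)
    have "measure lborel (I_alpha 1 - E) = 0"
    proof (rule gauss_density)
      show "I_alpha 1 - E \<in> sets borel" using E gauss.I_borel by auto
      show "0 < measure lborel E / 4" using n by (simp add: zero_less_measure_iff)
      fix bs
      let ?c = "cylinder 1 bs"
      have "?c \<inter> (G_alpha 1 ^^ length bs) -` E = ?c \<inter> E" using invn gauss.cylinder_subset by blast
      then have "measure lborel E * measure lborel ?c / 4 \<le> measure lborel (?c \<inter> E)"
        using gauss_renyi[OF E, of bs] by simp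
      moreover have "measure lborel (?c - ?c \<inter> E) = measure lborel ?c - measure lborel (?c \<inter> E)"
        using fmeasurable_subset_I1[OF gauss.cylinder_borel gauss.cylinder_subset] E gauss.cylinder_borel
        by (intro measure_Diff) (auto simp: fmeasurable_def top.not_eq_extremum)
      moreover have "(I_alpha 1 - E) \<inter> ?c = ?c - ?c \<inter> E" using gauss.cylinder_subset by blast
      ultimately show "measure lborel ((I_alpha 1 - E) \<inter> ?c) \<le> (1 - measure lborel E / 4) * measure lborel ?c"
        by (simp add: algebra_simps)
    qed auto
    then show False using \<open>measure lborel (I_alpha 1 - E) \<noteq> 0\<close> by simp
  qed
qed

section \<open>Birkhoff averages at Lebesgue almost every point\<close>

locale gauss_acip = alpha_acip 1 M for M
begin

lemma measurable_visits_G: "A \<in> sets M \<Longrightarrow> (\<lambda>x. real (visits G x A n)) \<in> borel_measurable M"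
  by (rule measurable_visits[OF measurable_G_M])

text \<open>The term \<open>K\<close> makes the exceptional set exactly invariant, so that ergodicity applies to it.\<close>

lemma AE_visits_upper:
  assumes A: "A \<in> sets M" and c: "measure M A < c"
  shows "AE x in lborel. x \<in> I \<longrightarrow> (\<forall>\<^sub>F n in sequentially. real (visits G x A n) < c * n)"
proof -
  have c0: "0 < c" using c by (meson measure_nonneg order_le_less_trans)
  define E where "E = {x \<in> space M. \<exists>K::nat. \<forall>m::nat. \<exists>n\<ge>m. c * real n - real K \<le> real (visits G x A n)}"
  have "E \<in> sets M"
  proof -
    have [measurable]: "(\<lambda>x. real (visits G x A n)) \<in> borel_measurable M" for n by (rule measurable_visits_G[OF A])
    show ?thesis unfolding E_def by measurable
  qed
  then have E: "E \<in> sets borel" "E \<subseteq> I" by (auto simp: mem_sets_M)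
  have "G x \<in> E \<longleftrightarrow> x \<in> E" if x: "x \<in> I" for x
  proof
    assume "G x \<in> E"
    then obtain K :: nat where K: "\<And>m. \<exists>n\<ge>m. c * real n - real K \<le> real (visits G (G x) A n)" by (auto simp: E_def)
    \<comment> \<open>Prepending a step raises \<open>c * n\<close> by \<open>c\<close>, which the
      enlarged constant absorbs; in the converse direction the dropped step costs at most one
      visit.\<close>
    have "\<exists>n\<ge>m. c * real n - real (K + nat \<lceil>c\<rceil>) \<le> real (visits G x A n)" for m
    proof -
      obtain n where n: "m \<le> n" "c * real n - real K \<le> real (visits G (G x) A n)" using K by blast
      have "real (visits G (G x) A n) \<le> real (visits G x A (Suc n))" by (simp add: visits_Suc)
      moreover have "c * real (Suc n) - real (K + nat \<lceil>c\<rceil>) \<le> c * real n - real K"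
        using real_nat_ceiling_ge[of c] by (simp add: algebra_simps)
      ultimately have "c * real (Suc n) - real (K + nat \<lceil>c\<rceil>) \<le> real (visits G x A (Suc n))" using n by linarith
      then show ?thesis using n by (intro exI[of _ "Suc n"]) simp
    qed
    then show "x \<in> E" using x unfolding E_def space_M by blast
  next
    assume "x \<in> E"
    then obtain K :: nat where K: "\<And>m. \<exists>n\<ge>m. c * real n - real K \<le> real (visits G x A n)" by (auto simp: E_def)
    have "\<exists>n\<ge>m. c * real n - real (K + 1) \<le> real (visits G (G x) A n)" for m
    proof -
      obtain n where n: "Suc m \<le> n" "c * real n - real K \<le> real (visits G x A n)" using K by blast
      then obtain n' where n': "n = Suc n'" by (cases n) auto
      have "real (visits G x A n) \<le> 1 + real (visits G (G x) A n')" unfolding n' by (simp add: visits_Suc)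
      moreover have "c * real n' \<le> c * real n" using c0 n' by simp
      ultimately have "c * real n' - real (K + 1) \<le> real (visits G (G x) A n')" using n by simp
      then show ?thesis using n n' by (intro exI[of _ n']) simp
    qed
    then show "G x \<in> E" using G_in_I unfolding E_def space_M by blast
  qed
  then consider "measure lborel E = 0" | "measure lborel (I - E) = 0"
    using gauss_ergodic[OF E] by blast
  then have "E \<in> null_sets lborel"
  proof cases
    case 1 then show ?thesis using emeasure_eq_measure2[OF fmeasurable_subset_I1[OF E]] E
      by (intro null_setsI) simp_all
  next
    case 2
    have IE: "I - E \<in> sets borel" using E I_borel by auto
    have "I - E \<in> null_sets lborel" using emeasure_eq_measure2[OF fmeasurable_subset_I1[OF IE Diff_subset]] IE 2
      by (intro null_setsI) simp_all
    then have "AE x in lborel. x \<in> I \<longrightarrow> x \<in> E" by (rule AE_I'[of "I - E"]) auto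
    then have ae: "AE x in M. x \<in> E" by (rule AE_M_of_lborel)
    \<comment> \<open>The gap between \<open>d\<close> and \<open>c\<close> absorbs the constant
      \<open>K\<close> once \<open>n\<close> is at least \<open>K / (c - d)\<close>. The maximal
      inequality then contradicts \<open>measure M A < d\<close>.\<close>
    define d where "d = (measure M A + c) / 2"
    have d: "measure M A < d" "d < c" using c by (auto simp: d_def)
    have "AE x in M. \<exists>n\<ge>1. d * real n \<le> real (visits G x A n)"
      using ae
    proof eventually_elim
      case (elim x)
      then obtain K :: nat where K: "\<And>m. \<exists>n\<ge>m. c * real n - real K \<le> real (visits G x A n)" by (auto simp: E_def)
      obtain m :: nat where m: "real K / (c - d) \<le> real m" by (meson real_arch_simple)
      obtain n where n: "max m 1 \<le> n" "c * real n - real K \<le> real (visits G x A n)" using K by blast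
      have "real K / (c - d) \<le> real n" using m n by linarith
      then have "real K \<le> (c - d) * real n" using d by (simp add: field_simps)
      then have "d * real n \<le> real (visits G x A n)" using n by (simp add: algebra_simps)
      then show ?case using n by (intro exI[of _ n]) auto
    qed
    then have "d \<le> measure M A" by (rule le_measure_of_visits[OF measurable_G_M distr_G_M A])
    then show ?thesis using d by simp
  qed
  then have "AE x in lborel. x \<notin> E" by (rule AE_not_in)
  then show ?thesis
  proof eventually_elim
    case (elim x)
    show ?case
    proof
      assume "x \<in> I"
      then have "\<not> (\<forall>m::nat. \<exists>n\<ge>m. c * real n - real 0 \<le> real (visits G x A n))"
        using elim unfolding E_def space_M by blast
      then show "\<forall>\<^sub>F n in sequentially. real (visits G x A n) < c * n"
        unfolding eventually_sequentially by (simp add: not_le) (metis linorder_not_le)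
    qed
  qed
qed

lemma AE_visits_limsup:
  assumes A: "A \<in> sets M"
  shows "AE x in lborel. x \<in> I \<longrightarrow> (\<forall>a > measure M A. \<forall>\<^sub>F n in sequentially. visits G x A n / n < a)"
proof -
  have "AE x in lborel. \<forall>k::nat. x \<in> I \<longrightarrow>
      (\<forall>\<^sub>F n in sequentially. real (visits G x A n) < (measure M A + 1 / Suc k) * n)"
    unfolding AE_all_countable by (intro allI AE_visits_upper[OF A]) simp
  then show ?thesis
  proof eventually_elim
    case (elim x)
    show ?case
    proof (intro impI allI)
      fix a assume x: "x \<in> I" and a: "measure M A < a"
      obtain k where k: "1 / real (Suc k) < a - measure M A"
        using nat_approx_posE[of "a - measure M A"] a by auto
      have "\<forall>\<^sub>F n in sequentially. real (visits G x A n) < (measure M A + 1 / Suc k) * n"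
        using elim x by blast
      then show "\<forall>\<^sub>F n in sequentially. visits G x A n / n < a"
        using eventually_gt_at_top[of 0]
      proof eventually_elim
        case (elim n)
        have "(measure M A + 1 / Suc k) * n \<le> a * n" using k by (intro mult_right_mono) auto
        then have "real (visits G x A n) < a * n" using elim by linarith
        then show ?case using elim by (simp add: pos_divide_less_eq)
      qed
    qed
  qed
qed

lemma AE_visits_lim:
  assumes A: "A \<in> sets M"
  shows "AE x in lborel. x \<in> I \<longrightarrow> (\<lambda>n. visits G x A n / n) \<longlonglongrightarrow> measure M A"
proof -
  have A': "I - A \<in> sets M" using A I_borel by (auto simp: mem_sets_M)
  have m: "measure M (I - A) = 1 - measure M A" using prob_compl[OF A] by (simp add: space_M)
  show ?thesis
    using AE_visits_limsup[OF A] AE_visits_limsup[OF A']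
  proof eventually_elim
    case (elim x)
    show ?case
    proof (intro impI order_tendstoI)
      assume x: "x \<in> I"
      show "\<forall>\<^sub>F n in sequentially. visits G x A n / n < a" if "measure M A < a" for a
        using elim x that by blast
      show "\<forall>\<^sub>F n in sequentially. a < visits G x A n / n" if a: "a < measure M A" for a
      proof -
        have "\<forall>\<^sub>F n in sequentially. visits G x (I - A) n / n < 1 - a"
          using elim x a m by auto
        then show ?thesis using eventually_gt_at_top[of 0]
        proof eventually_elim
          case (elim n)
          have "visits G x (I - A) n = visits G x (- A) n"
            using funpow_in_I[OF x] unfolding visits_def by auto
          then have "real (visits G x (I - A) n) = real n - real (visits G x A n)" by (simp add: visits_Compl)
          then show ?case using elim by (simp add: diff_divide_distrib)
        qed
      qed
    qed
  qed
qed

text \<open>Stated for Lebesgue measure, so that it passes to the invariant measure of any other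
  parameter. Only countably many cylinders have to be treated.\<close>

lemma AE_normal: "AE x in lborel. x \<in> I \<longrightarrow> normal x"
proof -
  have "AE x in lborel. \<forall>bs::int list. x \<in> I \<longrightarrow>
      (\<lambda>n. visits G x (cylinder 1 bs) n / n) \<longlonglongrightarrow> measure M (cylinder 1 bs)"
    unfolding AE_all_countable
    by (intro allI AE_visits_lim) (simp add: mem_sets_M cylinder_borel cylinder_subset)
  moreover have "AE x in lborel. x \<notin> \<rat>"
    by (rule AE_not_in[OF countable_imp_null_set_lborel[OF countable_rat]])
  ultimately show ?thesis by eventually_elim (simp add: normal_iff_cylinders)
qed

lemma ex_normal: "\<exists>x. normal x"
proof -
  have "AE x in M. normal x" by (rule AE_M_of_lborel[OF AE_normal])
  then show ?thesis using AE_contr[of normal] by blast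
qed

end

section \<open>Coding the orbits by blocks of the Gauss orbit\<close>

lemma visits_0 [simp]: "visits f x A 0 = 0"
  by (simp add: visits_def)

lemma floor_recip_pos:
  assumes "0 < u" "u < 1" shows "1 \<le> \<lfloor>1 / u\<rfloor>"
  using assms by simp

context alpha_cf
begin

definition shift :: "real \<Rightarrow> real" where
  "shift u = (if u < \<alpha> then u else u - 1)"

text \<open>\<open>height u\<close> is the number of steps that the orbit of \<open>shift u\<close> spends in the block of the
  Gauss digit of \<open>u\<close>.\<close>

definition height :: "real \<Rightarrow> nat" where
  "height u = (if u < \<alpha> then 1 else nat \<lfloor>1 / u\<rfloor>)"

lemma shift_in_I: "0 \<le> u \<Longrightarrow> u < 1 \<Longrightarrow> shift u \<in> I"
  using pos le1 by (auto simp: shift_def I_alpha_def)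

text \<open>\<open>I\<close> has length 1, so \<open>G z\<close> is the only point of
  \<open>I\<close> congruent to \<open>1 / \<bar>z\<bar>\<close> modulo 1. This replaces every later
  computation with the floor in \<open>G\<close>.\<close>

lemma G_eq_shift:
  assumes "z \<noteq> 0" "0 \<le> v" "v < 1" "1 / \<bar>z\<bar> - v \<in> \<int>"
  shows "G z = shift v"
proof -
  obtain m where m: "1 / \<bar>z\<bar> - v = of_int m" using assms(4) by (rule Ints_cases)
  define k where "k = \<lfloor>1 / \<bar>z\<bar> + 1 - \<alpha>\<rfloor>"
  define k' where "k' = m + (if v < \<alpha> then 0 else 1)"
  have G: "G z = v + of_int m - of_int k" using assms(1) m by (simp add: G_alpha_def k_def)
  have S: "shift v = v + of_int m - of_int k'" by (simp add: shift_def k'_def)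
  have "\<alpha> - 1 \<le> G z" "G z < \<alpha>" using G_in_I[of z] by (auto simp: I_alpha_def)
  moreover have "\<alpha> - 1 \<le> shift v" "shift v < \<alpha>" using shift_in_I[OF assms(2,3)] by (auto simp: I_alpha_def)
  ultimately have "real_of_int k - of_int k' < 1" "real_of_int k' - of_int k < 1" using G S by linarith+
  then have "k = k'" by linarith
  then show ?thesis using G S by simp
qed

text \<open>In the coordinate \<open>1 / u\<close> the map \<open>u / (1 - u)\<close> subtracts 1,
  which yields the closed form.\<close>

lemma funpow_in_block:
  assumes u: "\<alpha> \<le> u" "u < 1" "u \<notin> \<rat>" and "j < nat \<lfloor>1 / u\<rfloor>"
  shows "(G ^^ j) (shift u) = 1 / (1 / u - j) - 1"
  using assms(4)
proof (induction j)
  case 0 then show ?case using u pos by (simp add: shift_def)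
next
  case (Suc j)
  have u0: "0 < u" using u pos by simp
  have "real (Suc (Suc j)) \<le> of_int \<lfloor>1 / u\<rfloor>" using Suc.prems by linarith
  also have "\<dots> \<le> 1 / u" by simp
  finally have ge: "2 \<le> 1 / u - j" by simp
  \<comment> \<open>The value 2 would give \<open>v = 1\<close>, outside \<open>[0, 1)\<close>;
    irrationality of \<open>u\<close> excludes it.\<close>
  moreover have "1 / u - j \<noteq> 2"
  proof
    assume "1 / u - j = 2"
    then have "u = 1 / (2 + real j)" using u0 by (simp add: field_simps)
    then show False using u(3) by (metis Rats_1 Rats_add Rats_divide Rats_number_of Rats_of_nat)
  qed
  ultimately have gt: "2 < 1 / u - j" by simp
  define w where "w = 1 / u - j"
  define v where "v = 1 / (w - 1)"
  have w: "2 < w" using gt by (simp add: w_def)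
  have v: "0 < v" "v < 1" using w by (auto simp: v_def)
  have "(G ^^ Suc j) (shift u) = G (1 / w - 1)" using Suc by (simp add: w_def)
  also have "\<dots> = shift v"
  proof (rule G_eq_shift)
    have "1 / w < 1" using w by simp
    then show "1 / w - 1 \<noteq> 0" by linarith
    have "\<bar>1 / w - 1\<bar> = (w - 1) / w" using w by (simp add: abs_if field_simps)
    then have "1 / \<bar>1 / w - 1\<bar> = v + 1" using w by (simp add: v_def field_simps)
    then show "1 / \<bar>1 / w - 1\<bar> - v \<in> \<int>" by simp
  qed (use v in auto)
  also have "\<dots> = v - 1"
  proof -
    \<comment> \<open>The points \<open>v\<close> of a block are at least \<open>u\<close>, hence at
      least \<alpha>, so \<open>shift\<close> subtracts 1.\<close>
    have "1 / (1 / u) \<le> v" unfolding v_def using w u0 by (intro divide_left_mono) (auto simp: w_def)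
    then show ?thesis using u by (simp add: shift_def)
  qed
  also have "v = 1 / (1 / u - Suc j)" by (simp add: v_def w_def algebra_simps)
  finally show ?case .
qed

text \<open>For \<open>u \<ge> \<alpha>\<close> the last point of the block is
  \<open>- t / (1 + t)\<close> with \<open>t\<close> the Gauss image of \<open>u\<close>. The
  reciprocal of its modulus is \<open>1 + 1 / t\<close>, so the next step already applies the Gauss
  map to \<open>t\<close>.\<close>

lemma funpow_height:
  assumes u: "0 < u" "u < 1" "u \<notin> \<rat>"
  shows "(G ^^ height u) (shift u) =
    shift (if u < \<alpha> then G_alpha 1 u else G_alpha 1 (G_alpha 1 u))"
proof -
  define t where "t = G_alpha 1 u"
  have "t \<in> I_alpha 1" "t \<notin> \<rat>" unfolding t_def using gauss.G_in_I gauss.G_irrational[OF u(3)] by auto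
  then have t: "0 < t" "t < 1" by (auto simp: gauss_I less_le)
  have tu: "t = 1 / u - of_int \<lfloor>1 / u\<rfloor>" unfolding t_def using u by (simp add: G_alpha_def)
  show ?thesis
  proof (cases "u < \<alpha>")
    case True
    have "G u = shift t" by (rule G_eq_shift) (use u t tu in auto)
    then show ?thesis using True by (simp add: height_def shift_def t_def)
  next
    case False
    define a where "a = nat \<lfloor>1 / u\<rfloor>"
    have a: "1 \<le> a" "real a = of_int \<lfloor>1 / u\<rfloor>" using floor_recip_pos[OF u(1,2)] unfolding a_def by linarith+
    have "(G ^^ a) (shift u) = G ((G ^^ (a - 1)) (shift u))"
      using a by (cases a) auto
    also have "(G ^^ (a - 1)) (shift u) = 1 / (1 / u - real (a - 1)) - 1"
      using False u a(1) by (intro funpow_in_block) (auto simp: a_def)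
    also have "1 / u - real (a - 1) = 1 + t" using a tu by (simp add: of_nat_diff)
    also have "G (1 / (1 + t) - 1) = shift (G_alpha 1 t)"
    proof (rule G_eq_shift)
      have e: "\<bar>1 / (1 + t) - 1\<bar> = t / (1 + t)" using t by (simp add: abs_if field_simps)
      show "1 / (1 + t) - 1 \<noteq> 0" using t by (simp add: field_simps)
      show "0 \<le> G_alpha 1 t" "G_alpha 1 t < 1" using gauss.G_in_I[of t] by (auto simp: gauss_I)
      have "1 / \<bar>1 / (1 + t) - 1\<bar> - G_alpha 1 t = 1 + of_int \<lfloor>1 / t\<rfloor>"
        unfolding e using t by (simp add: G_alpha_def field_simps)
      then show "1 / \<bar>1 / (1 + t) - 1\<bar> - G_alpha 1 t \<in> \<int>" by simp
    qed
    finally show ?thesis using False by (simp add: height_def a_def t_def)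
  qed
qed

lemma height_le: assumes "0 < u" shows "height u \<le> nat \<lceil>1 / \<alpha>\<rceil>"
proof (cases "u < \<alpha>")
  case True
  have "0 < 1 / \<alpha>" using pos by simp
  then have "1 \<le> nat \<lceil>1 / \<alpha>\<rceil>" by linarith
  then show ?thesis using True by (simp add: height_def)
next
  case False
  have "1 / u \<le> 1 / \<alpha>" using False pos by (intro divide_left_mono) auto
  then have "\<lfloor>1 / u\<rfloor> \<le> \<lceil>1 / \<alpha>\<rceil>" by linarith
  then show ?thesis using False by (simp add: height_def nat_mono)
qed

lemma height_pos: assumes "0 < u" "u < 1" shows "1 \<le> height u"
proof -
  have "1 \<le> nat \<lfloor>1 / u\<rfloor>" using floor_recip_pos[OF assms] by linarith
  then show ?thesis by (simp add: height_def)
qed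

text \<open>\<open>state True y n\<close> tells whether the orbit of \<open>shift y\<close> enters the block of the \<open>n\<close>-th point of
  the Gauss orbit of \<open>y\<close>; the other blocks are skipped.\<close>

fun state :: "bool \<Rightarrow> real \<Rightarrow> nat \<Rightarrow> bool" where
  "state b y 0 = b"
| "state b y (Suc n) = (\<not> (state b y n \<and> \<alpha> \<le> (G_alpha 1 ^^ n) y))"

definition block_time :: "real \<Rightarrow> nat \<Rightarrow> nat" where
  "block_time y n = (\<Sum>i<n. if state True y i then height ((G_alpha 1 ^^ i) y) else 0)"

lemma block_time_0 [simp]: "block_time y 0 = 0" by (simp add: block_time_def)

lemma block_time_Suc:
  "block_time y (Suc n) = block_time y n + (if state True y n then height ((G_alpha 1 ^^ n) y) else 0)"
  by (simp add: block_time_def)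

lemma gauss_orbit:
  assumes "0 < y" "y < 1" "y \<notin> \<rat>"
  shows "0 < (G_alpha 1 ^^ n) y" "(G_alpha 1 ^^ n) y < 1" "(G_alpha 1 ^^ n) y \<notin> \<rat>"
proof -
  have "(G_alpha 1 ^^ n) y \<in> I_alpha 1" using assms by (intro gauss.funpow_in_I) (auto simp: gauss_I)
  moreover show "(G_alpha 1 ^^ n) y \<notin> \<rat>" using gauss.funpow_irrational[OF assms(3)] .
  ultimately show "0 < (G_alpha 1 ^^ n) y" "(G_alpha 1 ^^ n) y < 1" by (auto simp: gauss_I less_le)
qed

text \<open>If the block with index \<open>n\<close> is skipped, no time passes in it and the orbit
  already stands at the following Gauss point.\<close>

lemma funpow_block_time:
  assumes y: "0 < y" "y < 1" "y \<notin> \<rat>"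
  shows "(G ^^ block_time y n) (shift y) =
    shift ((G_alpha 1 ^^ (if state True y n then n else Suc n)) y)"
proof (induction n)
  case (Suc n)
  note o = gauss_orbit[OF y, of n]
  show ?case
  proof (cases "state True y n")
    case True
    have "(G ^^ block_time y (Suc n)) (shift y) = (G ^^ height ((G_alpha 1 ^^ n) y)) ((G ^^ block_time y n) (shift y))"
      using True by (simp add: block_time_Suc add.commute[of "block_time y n"] funpow_add)
    also have "\<dots> = (G ^^ height ((G_alpha 1 ^^ n) y)) (shift ((G_alpha 1 ^^ n) y))" using Suc True by simp
    finally show ?thesis using funpow_height[OF o] True by simp
  next
    case False
    then show ?thesis using Suc by (simp add: block_time_Suc)
  qed
qed simp

lemma visits_block_time:
  assumes y: "0 < y" "y < 1" "y \<notin> \<rat>"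
  shows "visits G (shift y) A (block_time y n) =
    (\<Sum>i<n. if state True y i then visits G (shift ((G_alpha 1 ^^ i) y)) A (height ((G_alpha 1 ^^ i) y)) else 0)"
proof (induction n)
  case 0 show ?case by (simp add: visits_def)
next
  case (Suc n)
  then show ?case using funpow_block_time[OF y, of n] by (simp add: block_time_Suc visits_add)
qed

text \<open>Replaces blocks of varying length by a fixed number of sets of Gauss points, one for
  each step \<open>j\<close> below \<open>nat \<lceil>1 / \<alpha>\<rceil>\<close>.\<close>

definition block_part :: "real set \<Rightarrow> nat \<Rightarrow> real set" where
  "block_part A j = {u. j < height u} \<inter> shift -` (G ^^ j) -` A"

lemma visits_height:
  assumes "height u \<le> K"
  shows "real (visits G (shift u) A (height u)) = (\<Sum>j<K. indicator (block_part A j) u)"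
proof -
  have "(\<Sum>j<K. indicator (block_part A j) u :: real) = (\<Sum>j<height u. indicator (block_part A j) u)"
    using assms by (intro sum.mono_neutral_right) (auto simp: block_part_def)
  also have "\<dots> = (\<Sum>j<height u. indicator A ((G ^^ j) (shift u)))"
    by (intro sum.cong) (auto simp: block_part_def indicator_def)
  finally show ?thesis by (simp add: visits_eq_sum)
qed

definition entries :: "real \<Rightarrow> real set \<Rightarrow> nat \<Rightarrow> real" where
  "entries y E n = (\<Sum>i<n. if state True y i \<and> (G_alpha 1 ^^ i) y \<in> E then 1 else 0)"

lemma visits_block_time_entries:
  assumes y: "0 < y" "y < 1" "y \<notin> \<rat>"
  shows "real (visits G (shift y) A (block_time y n)) = (\<Sum>j<nat \<lceil>1 / \<alpha>\<rceil>. entries y (block_part A j) n)"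
proof -
  let ?K = "nat \<lceil>1 / \<alpha>\<rceil>" and ?g = "\<lambda>i. (G_alpha 1 ^^ i) y"
  have "real (visits G (shift y) A (block_time y n)) =
    (\<Sum>i<n. if state True y i then real (visits G (shift (?g i)) A (height (?g i))) else 0)"
    unfolding visits_block_time[OF y] of_nat_sum by (intro sum.cong) auto
  also have "\<dots> = (\<Sum>i<n. \<Sum>j<?K. if state True y i \<and> ?g i \<in> block_part A j then 1 else 0)"
  proof (intro sum.cong refl)
    fix i
    have "height (?g i) \<le> ?K" using gauss_orbit(1)[OF y] by (rule height_le)
    note v = visits_height[OF this, of A]
    show "(if state True y i then real (visits G (shift (?g i)) A (height (?g i))) else 0) =
      (\<Sum>j<?K. if state True y i \<and> ?g i \<in> block_part A j then 1 else 0)"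
      by (cases "state True y i")
        (simp_all only: v indicator_def of_bool_def simp_thms if_True if_False sum.neutral_const)
  qed
  also have "\<dots> = (\<Sum>j<?K. entries y (block_part A j) n)"
    unfolding entries_def by (rule sum.swap)
  finally show ?thesis .
qed

lemma visits_UNIV: "visits f x UNIV n = n"
  by (simp add: visits_def)

lemma countable_frontier_shift_vimage:
  assumes "countable (frontier A)" shows "countable (frontier (shift -` A))"
proof (rule countable_frontier_vimage[of "{\<alpha>}", OF _ _ _ assms])
  fix x assume x: "x \<notin> {\<alpha>}"
  have "\<forall>\<^sub>F u in nhds x. shift u = (if x < \<alpha> then u else u - 1)"
  proof (cases "x < \<alpha>")
    case True
    have "\<forall>\<^sub>F u in nhds x. u \<in> {..<\<alpha>}" using True by (intro eventually_nhds_in_open) auto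
    then show ?thesis by eventually_elim (use True in \<open>simp add: shift_def\<close>)
  next
    case False
    have "\<forall>\<^sub>F u in nhds x. u \<in> {\<alpha><..}" using False x by (intro eventually_nhds_in_open) auto
    then show ?thesis by eventually_elim (use False in \<open>simp add: shift_def\<close>)
  qed
  then have "isCont shift x \<longleftrightarrow> isCont (\<lambda>u. if x < \<alpha> then u else u - 1) x" by (rule isCont_cong)
  then show "isCont shift x" by (cases "x < \<alpha>") simp_all
next
  fix c show "countable (shift -` {c})"
    by (rule countable_subset[of _ "{c, c + 1}"]) (auto simp: shift_def split: if_splits)
qed simp

lemma countable_frontier_block_part:
  assumes "countable (frontier A)" shows "countable (frontier (block_part A j))"
proof -
  \<comment> \<open>For \<open>u \<ge> \<alpha>\<close> the condition
    \<open>j < nat \<lfloor>1 / u\<rfloor>\<close> means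
    \<open>u \<le> 1 / real (Suc j)\<close>.\<close>
  have h: "{u. j < height u} = ({..<\<alpha>} \<inter> (if j = 0 then UNIV else {})) \<union> ({\<alpha>..} \<inter> {..1 / real (Suc j)})"
  proof (rule set_eqI)
    fix u
    show "u \<in> {u. j < height u} \<longleftrightarrow> u \<in> ({..<\<alpha>} \<inter> (if j = 0 then UNIV else {})) \<union> ({\<alpha>..} \<inter> {..1 / real (Suc j)})"
    proof (cases "u < \<alpha>")
      case False
      then have u: "0 < u" using pos by simp
      have "j < nat \<lfloor>1 / u\<rfloor> \<longleftrightarrow> real (Suc j) \<le> 1 / u" by linarith
      also have "\<dots> \<longleftrightarrow> u \<le> 1 / real (Suc j)" using u by (simp add: field_simps)
      finally show ?thesis using False by (simp add: height_def)
    qed (simp add: height_def)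
  qed
  have 1: "countable (frontier ({..<\<alpha>} \<inter> (if j = 0 then UNIV else {})))"
    by (intro countable_frontier_Int countable_frontier_lessThan) simp
  have 2: "countable (frontier ({\<alpha>..} \<inter> {..1 / real (Suc j)}))"
    by (intro countable_frontier_Int countable_frontier_atLeast) simp
  have "countable (frontier {u. j < height u})" unfolding h by (rule countable_frontier_Un[OF 1 2])
  then show ?thesis unfolding block_part_def
    by (intro countable_frontier_Int countable_frontier_shift_vimage countable_frontier_funpow_vimage assms)
qed

subsection \<open>Frequencies of entered blocks\<close>

lemma state_add: "state b y (i + L) = state (state b y i) ((G_alpha 1 ^^ i) y) L"
proof (induction L)
  case (Suc L)
  have "(G_alpha 1 ^^ (i + L)) y = (G_alpha 1 ^^ L) ((G_alpha 1 ^^ i) y)" by (metis add.commute comp_apply funpow_add)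
  then show ?case using Suc by simp
qed simp

text \<open>At a point below \<alpha> the next state is true whatever the present one is, so a
  single visit there makes both runs agree from then on.\<close>

lemma state_synchronized:
  "state True u L \<noteq> state False u L \<Longrightarrow> k < L \<Longrightarrow> \<alpha> \<le> (G_alpha 1 ^^ k) u"
proof (induction L)
  case (Suc L) then show ?case by (cases "k = L") auto
qed simp

lemma countable_frontier_state: "countable (frontier {u. state b u k})"
proof (induction k)
  case 0 show ?case by (cases b) simp_all
next
  case (Suc k)
  have "{u. state b u (Suc k)} = - ({u. state b u k} \<inter> (G_alpha 1 ^^ k) -` {\<alpha>..})" by auto
  then show ?case
    using countable_frontier_Compl[OF countable_frontier_Int[OF Suc gauss.countable_frontier_funpow_vimage[OF countable_frontier_atLeast]]]
    by simp
qed

text \<open>The state at a point of the orbit depends on its whole past. \<open>sure\<close> and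
  \<open>possible\<close> look back only \<open>L\<close> steps and take the state at that moment as
  unknown: entry holds for both initial states, or for at least one.\<close>

definition sure :: "real set \<Rightarrow> nat \<Rightarrow> real set" where
  "sure E L = {u. state True u L} \<inter> {u. state False u L} \<inter> (G_alpha 1 ^^ L) -` E"

definition possible :: "real set \<Rightarrow> nat \<Rightarrow> real set" where
  "possible E L = ({u. state True u L} \<union> {u. state False u L}) \<inter> (G_alpha 1 ^^ L) -` E"

definition stuck :: "nat \<Rightarrow> real set" where
  "stuck L = {u. \<forall>k<L. \<alpha> \<le> (G_alpha 1 ^^ k) u}"

lemma possible_subset: "possible E L \<subseteq> sure E L \<union> stuck L"
  using state_synchronized by (auto simp: possible_def sure_def stuck_def)

text \<open>The window starts \<open>L\<close> steps before the point that is judged. Shifting a sum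
  of values between 0 and 1 by \<open>L\<close> changes it by at most \<open>L\<close>.\<close>

lemma entries_bounds:
  "real (visits (G_alpha 1) y (sure E L) n) - L \<le> entries y E n"
  "entries y E n \<le> real (visits (G_alpha 1) y (possible E L) n) + L"
proof -
  let ?f = "\<lambda>i. if state True y i \<and> (G_alpha 1 ^^ i) y \<in> E then 1 else 0 :: real"
  have split: "(\<Sum>i<n. ?f (i + L)) + (\<Sum>i<L. ?f i) = (\<Sum>i<n. ?f i) + (\<Sum>i<L. ?f (n + i))"
  proof -
    have a: "(\<Sum>i<m + k. ?f i) = (\<Sum>i<m. ?f i) + (\<Sum>i<k. ?f (m + i))" for m k
      by (induction k) simp_all
    have "(\<Sum>i<L + n. ?f i) = (\<Sum>i<n + L. ?f i)" by (simp add: add.commute)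
    then show ?thesis unfolding a by (simp add: add.commute)
  qed
  have b: "0 \<le> (\<Sum>i<L. ?f (h i))" "(\<Sum>i<L. ?f (h i)) \<le> L" for h
    using sum_bounded_above[of "{..<L}" "\<lambda>i. ?f (h i)" 1] by (auto intro!: sum_nonneg)
  have g: "(G_alpha 1 ^^ (i + L)) y = (G_alpha 1 ^^ L) ((G_alpha 1 ^^ i) y)" for i
    by (metis add.commute comp_apply funpow_add)
  have "real (visits (G_alpha 1) y (sure E L) n) \<le> (\<Sum>i<n. ?f (i + L))"
    unfolding visits_eq_sum
  proof (intro sum_mono)
    fix i show "indicator (sure E L) ((G_alpha 1 ^^ i) y) \<le> ?f (i + L)"
      unfolding state_add g by (cases "state True y i") (auto simp: indicator_def sure_def)
  qed
  then show "real (visits (G_alpha 1) y (sure E L) n) - L \<le> entries y E n"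
    using split b[of "\<lambda>i. i"] b[of "\<lambda>i. n + i"] unfolding entries_def by linarith
  have "(\<Sum>i<n. ?f (i + L)) \<le> real (visits (G_alpha 1) y (possible E L) n)"
    unfolding visits_eq_sum
  proof (intro sum_mono)
    fix i show "?f (i + L) \<le> indicator (possible E L) ((G_alpha 1 ^^ i) y)"
      unfolding state_add g by (cases "state True y i") (auto simp: indicator_def possible_def)
  qed
  then show "entries y E n \<le> real (visits (G_alpha 1) y (possible E L) n) + L"
    using split b[of "\<lambda>i. i"] b[of "\<lambda>i. n + i"] unfolding entries_def by linarith
qed

end

section \<open>Change of time\<close>

text \<open>\<open>N\<close> has gaps at most \<open>K\<close> and \<open>C\<close> grows by at most
  one per step, so averages at time \<open>m\<close> and at the last sampled time before it differ
  by at most \<open>2 * K / m\<close>. Along the sampled times the average is the quotient of the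
  two given limits.\<close>

lemma LIMSEQ_div_time_change:
  fixes C :: "nat \<Rightarrow> nat" and N :: "nat \<Rightarrow> nat"
  assumes C: "\<And>m k. C m \<le> C (m + k)" "\<And>m k. C (m + k) \<le> C m + k" "C 0 = 0"
    and N: "N 0 = 0" "\<And>n. N n \<le> N (Suc n)" "\<And>n. N (Suc n) \<le> N n + K"
    and lim: "(\<lambda>n. real (C (N n)) / n) \<longlonglongrightarrow> s" "(\<lambda>n. real (N n) / n) \<longlonglongrightarrow> \<kappa>" "0 < \<kappa>"
  shows "(\<lambda>m. real (C m) / m) \<longlonglongrightarrow> s / \<kappa>"
proof -
  have NK: "N n \<le> K * n" for n
  proof (induction n)
    case (Suc n) then show ?case using N(3)[of n] by simp
  qed (use N in simp)
  have monoN: "mono N" using N(2) by (simp add: mono_iff_le_Suc)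
  have "\<forall>\<^sub>F n in sequentially. \<kappa> / 2 < real (N n) / n" using lim(2,3) by (intro order_tendstoD) auto
  have unbounded: "\<exists>n. m < N n" for m
  proof -
    have "\<forall>\<^sub>F n in sequentially. \<kappa> / 2 < real (N n) / n \<and> 2 * real m / \<kappa> < real n \<and> 0 < n"
      using \<open>\<forall>\<^sub>F n in sequentially. \<kappa> / 2 < real (N n) / n\<close> eventually_gt_at_top[of 0]
        filterlim_at_top_dense[THEN iffD1, rule_format, OF filterlim_real_sequentially, of "2 * real m / \<kappa>"]
      by eventually_elim auto
    then obtain n where n: "\<kappa> / 2 < real (N n) / n" "2 * real m / \<kappa> < real n" "0 < n"
      using eventually_happens'[OF sequentially_bot] by blast
    have "real m < \<kappa> / 2 * n" using n(2) lim(3) by (simp add: field_simps)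
    also have "\<dots> < real (N n)" using n(1,3) by (simp add: field_simps)
    finally show ?thesis by auto
  qed
  \<comment> \<open>The value \<open>N (i m)\<close> is the last sampled time not after
    \<open>m\<close>; \<open>N\<close> may stay constant for a while, which the least index allows
    for.\<close>
  define i where "i m = (LEAST n. m < N (Suc n))" for m
  have i: "N (i m) \<le> m" "m < N (Suc (i m))" for m
  proof -
    have ex: "\<exists>n. m < N (Suc n)" using unbounded[of m] N(1) by (metis not0_implies_Suc not_less_zero)
    then show "m < N (Suc (i m))" unfolding i_def by (rule LeastI_ex)
    show "N (i m) \<le> m"
    proof (cases "i m")
      case (Suc k)
      then have "\<not> m < N (Suc k)" using not_less_Least[of k "\<lambda>n. m < N (Suc n)"] by (simp add: i_def)
      then show ?thesis using Suc by simp
    qed (use N in simp)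
  qed
  have il: "filterlim i at_top sequentially"
  proof (rule filterlim_at_top[THEN iffD2, rule_format])
    fix Z
    have "Z \<le> i m" if "K * Z \<le> m" for m
    proof (rule ccontr)
      assume "\<not> Z \<le> i m"
      then have "N (Suc (i m)) \<le> N Z" using monoN by (simp add: monoD)
      then show False using i(2)[of m] NK[of Z] that by linarith
    qed
    then show "\<forall>\<^sub>F m in sequentially. Z \<le> i m" by (rule eventually_sequentiallyI)
  qed
  have "(\<lambda>n. (real (C (N n)) / n) / (real (N n) / n)) \<longlonglongrightarrow> s / \<kappa>"
    using lim by (intro tendsto_divide) auto
  moreover have "\<forall>\<^sub>F n in sequentially. (real (C (N n)) / n) / (real (N n) / n) = real (C (N n)) / real (N n)"
    using eventually_gt_at_top[of 0] by eventually_elim simp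
  ultimately have "(\<lambda>n. real (C (N n)) / real (N n)) \<longlonglongrightarrow> s / \<kappa>"
    by (rule Lim_transform_eventually)
  then have 1: "(\<lambda>m. real (C (N (i m))) / real (N (i m))) \<longlonglongrightarrow> s / \<kappa>"
    using il by (rule filterlim_compose)
  have 2: "(\<lambda>m. 2 * real K * inverse (real m)) \<longlonglongrightarrow> 2 * real K * 0"
    by (intro tendsto_intros lim_inverse_n)
  have diff: "\<bar>real (C m) / m - real (C (N (i m))) / real (N (i m))\<bar> \<le> 2 * real K * inverse (real m)"
    if "0 < m" for m
  proof -
    define a where "a = N (i m)"
    have a: "a \<le> m" "m \<le> a + K" using i[of m] N(3)[of "i m"] by (auto simp: a_def)
    have ca: "C a \<le> a" using C(2)[of 0 a] C(3) by simp
    have c: "C a \<le> C m" "C m \<le> C a + K"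
      using C(1)[of a "m - a"] C(2)[of a "m - a"] a by auto
    show ?thesis
    proof (cases "a = 0")
      case True
      then have "C a = 0" using C(3) by simp
      then have "real (C m) / m \<le> real K / m" using c that by (intro divide_right_mono) auto
      then show ?thesis using True that unfolding a_def[symmetric] by (simp add: field_simps)
    next
      case False
      have e: "real (C m) / m - real (C a) / a = (real (C m) - real (C a)) / m - (real (C a) / a) * ((real m - real a) / m)"
        using that False by (simp add: field_simps)
      have "0 \<le> (real (C m) - real (C a)) / m" "(real (C m) - real (C a)) / m \<le> real K / m"
        using c that by (auto intro!: divide_right_mono divide_nonneg_nonneg)
      moreover have "0 \<le> (real (C a) / a) * ((real m - real a) / m)" using a by simp
      moreover have "(real (C a) / a) * ((real m - real a) / m) \<le> 1 * (real K / m)"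
        using ca a that False by (intro mult_mono divide_right_mono) auto
      ultimately have "\<bar>real (C m) / m - real (C a) / a\<bar> \<le> real K / m + real K / m" unfolding e by linarith
      then show ?thesis unfolding a_def by (simp add: field_simps)
    qed
  qed
  have "(\<lambda>m. real (C m) / m - real (C (N (i m))) / real (N (i m))) \<longlonglongrightarrow> 0"
  proof (rule Lim_null_comparison[OF _ 2[simplified]])
    show "\<forall>\<^sub>F m in sequentially. norm (real (C m) / m - real (C (N (i m))) / real (N (i m))) \<le> 2 * real K * inverse (real m)"
      using eventually_gt_at_top[of 0] by eventually_elim (use diff in \<open>simp only: real_norm_def\<close>)
  qed
  from tendsto_add[OF this 1] show ?thesis by simp
qed

lemma visits_mono_time: "visits f x A m \<le> visits f x A (m + k)" "visits f x A (m + k) \<le> visits f x A m + k"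
  using visits_le[of f "(f ^^ m) x" A k] by (auto simp: visits_add)

section \<open>Gauss-normal points are normal\<close>

locale two_acips = alpha_acip \<alpha> M + full: gauss_acip M1 for \<alpha> :: real and M M1 :: "real measure"
begin

lemma full_normal_bounds: assumes "full.normal y" shows "0 < y" "y < 1" "y \<notin> \<rat>"
  using assms by (auto simp: full.normal_def gauss_I less_le)

lemma countable_frontier_sure_possible_stuck:
  assumes "countable (frontier E)"
  shows "countable (frontier (sure E L))" "countable (frontier (possible E L))" "countable (frontier (stuck L))"
proof -
  show "countable (frontier (sure E L))" "countable (frontier (possible E L))"
    unfolding sure_def possible_def
    by (intro countable_frontier_Int countable_frontier_Un countable_frontier_state
        gauss.countable_frontier_funpow_vimage assms)+
  show "countable (frontier (stuck L))"
  proof (induction L)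
    case (Suc L)
    have "stuck (Suc L) = stuck L \<inter> (G_alpha 1 ^^ L) -` {\<alpha>..}" by (auto simp: stuck_def less_Suc_eq)
    then show ?case
      using countable_frontier_Int[OF Suc gauss.countable_frontier_funpow_vimage[OF countable_frontier_atLeast]] by simp
  qed (simp add: stuck_def)
qed

lemma mem_sets_full: "countable (frontier E) \<Longrightarrow> E \<inter> full.I \<in> sets M1"
  using borel_of_countable_frontier gauss.I_borel by (auto simp: full.mem_sets_M)

text \<open>The sets decrease to the points whose Gauss orbit never meets
  \<open>[0, \<alpha>)\<close>, a null set by \<open>gauss_avoid_null\<close>.\<close>

lemma measure_stuck_lim: "(\<lambda>L. measure M1 (stuck L \<inter> full.I)) \<longlonglongrightarrow> 0"
proof -
  have s: "stuck L \<inter> full.I \<in> sets M1" for L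
    by (rule mem_sets_full[OF countable_frontier_sure_possible_stuck(3)[of "{}"]]) simp
  have "(\<lambda>L. measure M1 (stuck L \<inter> full.I)) \<longlonglongrightarrow> measure M1 (\<Inter>L. stuck L \<inter> full.I)"
    by (rule full.finite_Lim_measure_decseq) (use s in \<open>auto intro!: decseq_SucI simp: stuck_def\<close>)
  moreover have "measure M1 (\<Inter>L. stuck L \<inter> full.I) = 0"
  proof -
    let ?T = "{x \<in> full.I. \<forall>k. \<alpha> \<le> (G_alpha 1 ^^ k) x}"
    have e: "(\<Inter>L. stuck L \<inter> full.I) = ?T" by (auto simp: stuck_def)
    have "(\<Inter>L. stuck L \<inter> full.I) \<in> sets M1" using s by (intro sets.countable_INT) auto
    then have T: "?T \<in> sets borel" unfolding e by (simp add: full.mem_sets_M)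
    have "?T \<in> null_sets lborel"
      using emeasure_eq_measure2[OF fmeasurable_subset_I1[OF T]] gauss_avoid_null[OF pos le1] T
      by (intro null_setsI) simp_all
    then have "?T \<in> null_sets M1" by (rule full.null_sets_M) auto
    then show ?thesis unfolding e by (rule measure_eq_0_null_sets)
  qed
  ultimately show ?thesis by simp
qed

text \<open>Gauss normality gives the limits \<open>p L\<close> and \<open>r L\<close> for the lower
  and upper bounds with window \<open>L\<close>, and \<open>r L \<le> p L + t L\<close> with
  \<open>t L\<close> tending to 0. All of these are values of \<open>M1\<close>, so the limit is the
  same for every \<open>y\<close>.\<close>

lemma entries_lim:
  assumes E: "countable (frontier E)"
  shows "\<exists>s. \<forall>y. full.normal y \<longrightarrow> (\<lambda>n. entries y E n / n) \<longlonglongrightarrow> s"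
proof -
  define p where "p L = measure M1 (sure E L \<inter> full.I)" for L
  define r where "r L = measure M1 (possible E L \<inter> full.I)" for L
  define t where "t L = measure M1 (stuck L \<inter> full.I)" for L
  note cf = countable_frontier_sure_possible_stuck[OF E]
  have bdd: "bdd_above (range p)" by (rule bdd_aboveI[of _ 1]) (auto simp: p_def full.prob_le_1)
  define s where "s = (SUP L. p L)"
  have ps: "p L \<le> s" for L unfolding s_def by (rule cSUP_upper[OF _ bdd]) simp
  have rpt: "r L \<le> p L + t L" for L
  proof -
    have "r L \<le> measure M1 ((sure E L \<inter> full.I) \<union> (stuck L \<inter> full.I))"
      unfolding r_def using possible_subset[of E L] mem_sets_full[OF cf(1)] mem_sets_full[OF cf(3)]
      by (intro full.finite_measure_mono) auto
    also have "\<dots> \<le> p L + t L" unfolding p_def t_def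
      by (intro measure_Un_le mem_sets_full cf)
    finally show ?thesis .
  qed
  have small: "\<forall>\<^sub>F n in sequentially. real L / n < e" if "0 < e" for L and e :: real
  proof -
    have "(\<lambda>n. real L * inverse (real n)) \<longlonglongrightarrow> real L * 0" by (intro tendsto_intros lim_inverse_n)
    then have "\<forall>\<^sub>F n in sequentially. real L * inverse (real n) < e" using that by (intro order_tendstoD) auto
    then show ?thesis by (simp add: divide_inverse)
  qed
  have "(\<lambda>n. entries y E n / n) \<longlonglongrightarrow> s" if y: "full.normal y" for y
  proof (rule order_tendstoI)
    fix a assume "a < s"
    then obtain L where L: "a < p L" unfolding s_def using less_cSUP_iff[OF _ bdd] by auto
    have "(\<lambda>n. visits (G_alpha 1) y (sure E L) n / n) \<longlonglongrightarrow> p L"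
      using y cf(1) unfolding full.normal_def p_def by blast
    then have "\<forall>\<^sub>F n in sequentially. (a + p L) / 2 < visits (G_alpha 1) y (sure E L) n / n"
      using L by (intro order_tendstoD) auto
    then show "\<forall>\<^sub>F n in sequentially. a < entries y E n / n"
      using small[of "(p L - a) / 2" L, OF half_gt_zero[OF L[THEN diff_gt_0_iff_gt[THEN iffD2]]]]
    proof eventually_elim
      case (elim n)
      have "(real (visits (G_alpha 1) y (sure E L) n) - L) / n \<le> entries y E n / n"
        by (intro divide_right_mono entries_bounds) simp
      then show ?case using elim unfolding diff_divide_distrib by argo
    qed
  next
    fix a assume a: "s < a"
    have "\<forall>\<^sub>F L in sequentially. t L < a - s"
      using measure_stuck_lim a unfolding t_def by (intro order_tendstoD) auto
    then obtain L where "t L < a - s" using eventually_happens'[OF sequentially_bot] by blast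
    then have L: "r L < a" using rpt[of L] ps[of L] by linarith
    have "(\<lambda>n. visits (G_alpha 1) y (possible E L) n / n) \<longlonglongrightarrow> r L"
      using y cf(2) unfolding full.normal_def r_def by blast
    then have "\<forall>\<^sub>F n in sequentially. visits (G_alpha 1) y (possible E L) n / n < (a + r L) / 2"
      using L by (intro order_tendstoD) auto
    then show "\<forall>\<^sub>F n in sequentially. entries y E n / n < a"
      using small[of "(a - r L) / 2" L, OF half_gt_zero[OF L[THEN diff_gt_0_iff_gt[THEN iffD2]]]]
    proof eventually_elim
      case (elim n)
      have "entries y E n / n \<le> (real (visits (G_alpha 1) y (possible E L) n) + L) / n"
        by (intro divide_right_mono entries_bounds) simp
      then show ?case using elim unfolding add_divide_distrib by argo
    qed
  qed
  then show ?thesis by blast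
qed

text \<open>A skipped block is always followed by an entered one, so two consecutive blocks take at
  least one step.\<close>

lemma block_time_lower:
  assumes "0 < y" "y < 1" "y \<notin> \<rat>" shows "k \<le> block_time y (2 * k)"
proof (induction k)
  case (Suc k)
  have h: "1 \<le> height ((G_alpha 1 ^^ n) y)" for n using gauss_orbit[OF assms, of n] height_pos by blast
  have "block_time y (2 * k) + 1 \<le> block_time y (Suc (Suc (2 * k)))"
    using h[of "2 * k"] h[of "Suc (2 * k)"] by (simp add: block_time_Suc del: funpow.simps)
  then show ?case using Suc by simp
qed simp

text \<open>\<open>S B\<close> is the mean number of visits to \<open>B\<close> per Gauss step. For
  \<open>UNIV\<close> visits count time, so \<open>S UNIV\<close> is the mean time per Gauss step,
  at least 1/2 by \<open>block_time_lower\<close>.\<close>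

lemma visits_lim:
  assumes A: "countable (frontier A)"
  shows "\<exists>r. \<forall>y. full.normal y \<longrightarrow> (\<lambda>m. visits G (shift y) A m / m) \<longlonglongrightarrow> r"
proof -
  let ?K = "nat \<lceil>1 / \<alpha>\<rceil>"
  have "\<forall>B. \<exists>s. countable (frontier B) \<longrightarrow> (\<forall>y. full.normal y \<longrightarrow> (\<lambda>n. entries y B n / n) \<longlonglongrightarrow> s)"
    using entries_lim by blast
  then obtain s where s: "\<And>B y. countable (frontier B) \<Longrightarrow> full.normal y \<Longrightarrow> (\<lambda>n. entries y B n / n) \<longlonglongrightarrow> s B"
    by metis
  define S where "S B = (\<Sum>j<?K. s (block_part B j))" for B
  have S: "(\<lambda>n. visits G (shift y) B (block_time y n) / n) \<longlonglongrightarrow> S B"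
    if "countable (frontier B)" "full.normal y" for B y
    unfolding visits_block_time_entries[OF full_normal_bounds[OF that(2)]] sum_divide_distrib S_def
    by (intro tendsto_sum s countable_frontier_block_part that)
  have "(\<lambda>m. visits G (shift y) A m / m) \<longlonglongrightarrow> S A / S UNIV" if y: "full.normal y" for y
  proof (rule LIMSEQ_div_time_change[where N = "block_time y" and K = ?K])
    note b = full_normal_bounds[OF y]
    show "block_time y (Suc n) \<le> block_time y n + ?K" for n
      using height_le[OF gauss_orbit(1)[OF b, of n]] by (simp add: block_time_Suc)
    show "(\<lambda>n. visits G (shift y) A (block_time y n) / n) \<longlonglongrightarrow> S A" by (rule S[OF A y])
    show lim: "(\<lambda>n. block_time y n / n) \<longlonglongrightarrow> S UNIV" using S[of UNIV y] y by (simp add: visits_UNIV)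
    have "(\<lambda>k. block_time y (2 * k) / real (2 * k)) \<longlonglongrightarrow> S UNIV"
      using LIMSEQ_subseq_LIMSEQ[OF lim, of "\<lambda>k. 2 * k"] by (simp add: strict_mono_def o_def)
    moreover have "\<forall>k\<ge>1. 1 / 2 \<le> block_time y (2 * k) / real (2 * k)"
    proof (intro allI impI)
      fix k :: nat assume "1 \<le> k"
      moreover have "real k \<le> real (block_time y (2 * k))" using block_time_lower[OF b, of k] by linarith
      ultimately show "1 / 2 \<le> block_time y (2 * k) / real (2 * k)" by (simp add: field_simps)
    qed
    ultimately have "1 / 2 \<le> S UNIV" using LIMSEQ_le_const by blast
    then show "0 < S UNIV" by simp
  qed (simp_all add: block_time_Suc visits_mono_time)
  then show ?thesis by blast
qed

text \<open>Nonnegative points of \<open>I\<close> already lie in \<open>[0, 1)\<close>, negative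
  ones after a translation by 1, which preserves Lebesgue null sets.\<close>

lemma AE_full_normal: "AE x in M. \<exists>y. full.normal y \<and> x = shift y"
proof -
  have a: "AE x in lborel. x \<in> full.I \<longrightarrow> full.normal x" by (rule full.AE_normal)
  then obtain Z where Z: "{x \<in> space lborel. \<not> (x \<in> full.I \<longrightarrow> full.normal x)} \<subseteq> Z" "emeasure lborel Z = 0" "Z \<in> sets lborel"
    by (rule AE_E)
  have "emeasure lborel ((+) 1 -` Z) = emeasure (distr lborel borel ((+) 1)) Z"
    using Z by (subst emeasure_distr) auto
  then have "(+) 1 -` Z \<in> null_sets lborel"
    using Z measurable_sets[of "(+) 1" borel borel Z] by (intro null_setsI) (auto simp: lborel_distr_plus)
  moreover have "{x \<in> space lborel. \<not> (1 + x \<in> full.I \<longrightarrow> full.normal (1 + x))} \<subseteq> (+) 1 -` Z" using Z by auto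
  ultimately have b: "AE x in lborel. 1 + x \<in> full.I \<longrightarrow> full.normal (1 + x)" by (rule AE_I')
  have "AE x in lborel. x \<in> I \<longrightarrow> (\<exists>y. full.normal y \<and> x = shift y)"
    using a b
  proof eventually_elim
    case (elim x)
    show ?case
    proof
      assume x: "x \<in> I"
      show "\<exists>y. full.normal y \<and> x = shift y"
      proof (cases "x < 0")
        case True
        have "full.normal (1 + x)" using elim True x pos by (auto simp: gauss_I I_alpha_def)
        moreover have "x = shift (1 + x)" using x by (simp add: shift_def I_alpha_def)
        ultimately show ?thesis by blast
      next
        case False
        have "full.normal x" using elim False x le1 by (auto simp: gauss_I I_alpha_def)
        moreover have "x = shift x" using x by (simp add: shift_def I_alpha_def)
        ultimately show ?thesis by blast
      qed
    qed
  qed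
  then show ?thesis by (rule AE_M_of_lborel)
qed

text \<open>The invariance of \<open>M\<close> and bounded convergence identify the limit, without
  ergodicity of \<open>G\<close> with respect to \<open>M\<close>.\<close>

lemma normal_shift_of_full_normal:
  assumes y: "full.normal y" shows "normal (shift y)"
proof -
  have "(\<lambda>m. visits G (shift y) A m / m) \<longlonglongrightarrow> measure M (A \<inter> I)" if A: "countable (frontier A)" for A
  proof -
    obtain r where r: "\<And>y. full.normal y \<Longrightarrow> (\<lambda>m. visits G (shift y) A m / m) \<longlonglongrightarrow> r"
      using visits_lim[OF A] by blast
    have AI: "A \<inter> I \<in> sets M" using borel_of_countable_frontier[OF A] I_borel by (auto simp: mem_sets_M)
    have vAI: "visits G x (A \<inter> I) m = visits G x A m" if "x \<in> I" for x m
      using funpow_in_I[OF that] by (auto simp: visits_def)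
    have "(\<lambda>m. \<integral>x. visits G x (A \<inter> I) m / m \<partial>M) \<longlonglongrightarrow> (\<integral>x. r \<partial>M)"
    proof (rule integral_dominated_convergence[where w = "\<lambda>_. 1"])
      show "AE x in M. (\<lambda>m. visits G x (A \<inter> I) m / m) \<longlonglongrightarrow> r"
        using AE_full_normal AE_space
      proof eventually_elim
        case (elim x)
        then show ?case using r by (auto simp: space_M vAI)
      qed
      show "AE x in M. norm (visits G x (A \<inter> I) m / real m) \<le> 1" for m
        using visits_le[of G _ "A \<inter> I" m] by (auto simp: divide_le_eq_1 intro!: AE_I2)
      show "(\<lambda>x. visits G x (A \<inter> I) m / real m) \<in> borel_measurable M" for m
        using measurable_visits[OF measurable_G_M AI] by (intro borel_measurable_divide) auto
    qed simp_all
    moreover have "\<forall>\<^sub>F m in sequentially. (\<integral>x. visits G x (A \<inter> I) m / m \<partial>M) = measure M (A \<inter> I)"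
      using eventually_gt_at_top[of 0]
      by eventually_elim (simp add: integral_visits[OF measurable_G_M distr_G_M AI])
    ultimately have "(\<lambda>m. measure M (A \<inter> I)) \<longlonglongrightarrow> (\<integral>x. r \<partial>M)" by (rule Lim_transform_eventually)
    then have "measure M (A \<inter> I) = r" by (simp add: LIMSEQ_const_iff prob_space)
    then show ?thesis using r[OF y] by simp
  qed
  moreover have "shift y \<in> I" using full_normal_bounds[OF y] by (intro shift_in_I) auto
  moreover have "shift y \<notin> \<rat>"
  proof
    assume "shift y \<in> \<rat>"
    then have "shift y + (if y < \<alpha> then 0 else 1) \<in> \<rat>" by (intro Rats_add) auto
    then show False using full_normal_bounds[OF y] by (auto simp: shift_def split: if_splits)
  qed
  ultimately show ?thesis by (auto simp: normal_def)
qed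

end

section \<open>Normal points are Gauss-normal\<close>

text \<open>Starting one step later changes each count by at most 1. This is used because the
  reverse coding follows the Gauss orbit only from its second point on.\<close>

lemma visits_lim_step:
  "(\<lambda>m. visits f (f x) A m / m) \<longlonglongrightarrow> r \<longleftrightarrow> (\<lambda>m. visits f x A m / m) \<longlonglongrightarrow> r"
proof (rule Lim_transform_eq)
  show "(\<lambda>m. visits f (f x) A m / m - visits f x A m / m) \<longlonglongrightarrow> 0"
  proof (rule Lim_null_comparison[OF _ lim_inverse_n])
    have "norm (visits f (f x) A m / m - visits f x A m / m) \<le> inverse (real m)" for m
    proof -
      have "visits f x A (Suc m) = (if x \<in> A then 1 else 0) + visits f (f x) A m" by (rule visits_Suc)
      then have "\<bar>real (visits f (f x) A m) - real (visits f x A m)\<bar> \<le> 1"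
        using visits_mono_time[of f x A m 1] by (auto split: if_splits)
      then have "\<bar>real (visits f (f x) A m) - real (visits f x A m)\<bar> / m \<le> 1 / m"
        by (intro divide_right_mono) auto
      then show ?thesis by (simp add: diff_divide_distrib[symmetric] inverse_eq_divide)
    qed
    then show "\<forall>\<^sub>F m in sequentially. norm (visits f (f x) A m / m - visits f x A m / m) \<le> inverse (real m)"
      by simp
  qed
qed

text \<open>Inverse of \<open>shift\<close> on \<open>I\<close>; the sign alone tells which branch
  of \<open>shift\<close> was used, so the formula is free of \<alpha>.\<close>

definition unshift :: "real \<Rightarrow> real" where
  "unshift z = (if z < 0 then z + 1 else z)"

text \<open>The number of steps by which the Gauss orbit advances during one step of \<open>G\<close>.\<close>

definition advance :: "real \<Rightarrow> nat" where
  "advance z = (if z \<ge> 0 then 1 else if z > - 1 / 2 then 2 else 0)"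

text \<open>During a step of \<open>G\<close> that advances, the Gauss orbit leaves
  \<open>G_alpha 1 (unshift z)\<close> and, if the advance is 2, also the next point. The first and
  second parts test these two points for membership in \<open>E\<close>.\<close>

definition first_part :: "real set \<Rightarrow> real set" where
  "first_part E = {- 1 / 2<..} \<inter> unshift -` (G_alpha 1 -` E)"

definition second_part :: "real set \<Rightarrow> real set" where
  "second_part E = ({- 1 / 2<..} \<inter> {..<0}) \<inter> unshift -` (G_alpha 1 -` (G_alpha 1 -` E))"

context alpha_cf
begin

lemma unshift_shift: "0 \<le> u \<Longrightarrow> u < 1 \<Longrightarrow> unshift (shift u) = u"
  by (auto simp: shift_def unshift_def)

lemma shift_unshift: "z \<in> I \<Longrightarrow> shift (unshift z) = z"
  by (auto simp: shift_def unshift_def I_alpha_def)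

lemma unshift_bounds:
  assumes "z \<in> I" "z \<notin> \<rat>" shows "0 < unshift z" "unshift z < 1" "unshift z \<notin> \<rat>"
proof -
  have "z \<noteq> 0" using assms by auto
  moreover have "z + 1 \<notin> \<rat>"
  proof
    assume "z + 1 \<in> \<rat>"
    then have "z + 1 - 1 \<in> \<rat>" by (intro Rats_diff) auto
    then show False using assms by simp
  qed
  ultimately show "0 < unshift z" "unshift z < 1" "unshift z \<notin> \<rat>"
    using assms pos le1 by (auto simp: unshift_def I_alpha_def)
qed

text \<open>The Gauss image is followed because inside a block \<open>u / (1 - u)\<close> generally
  leaves the Gauss orbit. It only lowers the first digit of \<open>u\<close> by one, hence has the
  same Gauss image as \<open>u\<close>, and the advance is 0.\<close>

lemma G1_unshift_G:
  assumes z: "z \<in> I" "z \<notin> \<rat>"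
  shows "G_alpha 1 (unshift (G z)) = (G_alpha 1 ^^ advance z) (G_alpha 1 (unshift z))"
proof -
  define u where "u = unshift z"
  have u: "0 < u" "u < 1" "u \<notin> \<rat>" using unshift_bounds[OF z] by (auto simp: u_def)
  have zu: "z = shift u" using shift_unshift[OF z(1)] by (simp add: u_def)
  have g: "0 \<le> G_alpha 1 x" "G_alpha 1 x < 1" for x using gauss.G_in_I[of x] by (auto simp: gauss_I)
  have "z \<noteq> - 1 / 2" using z(2) by auto
  then consider "0 \<le> z" | "- 1 / 2 < z" "z < 0" | "z < - 1 / 2" by linarith
  then show ?thesis
  proof cases
    case 1
    then have "u < \<alpha>" using z by (simp add: u_def unshift_def I_alpha_def)
    then have "G z = shift (G_alpha 1 u)" using funpow_height[OF u] zu by (simp add: height_def)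
    then show ?thesis using 1 unshift_shift[OF g] by (simp add: advance_def u_def)
  next
    case 2
    then have u2: "1 / 2 < u" "\<alpha> \<le> u" using z by (auto simp: u_def unshift_def I_alpha_def)
    then have "1 / u < 2" "1 < 1 / u" using u by (auto simp: field_simps)
    then have "\<lfloor>1 / u\<rfloor> = 1" by linarith
    then have "height u = 1" using u2 by (simp add: height_def)
    then have "G z = shift (G_alpha 1 (G_alpha 1 u))" using funpow_height[OF u] zu u2 by simp
    then show ?thesis using 2 unshift_shift[OF g] by (simp add: advance_def u_def numeral_2_eq_2)
  next
    case 3
    then have u2: "u < 1 / 2" "\<alpha> \<le> u" using z by (auto simp: u_def unshift_def I_alpha_def)
    then have u3: "2 < 1 / u" using u by (simp add: field_simps)
    then have "1 < nat \<lfloor>1 / u\<rfloor>" by linarith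
    then have Gz: "G z = 1 / (1 / u - 1) - 1" using funpow_in_block[OF u2(2) u(2,3), of 1] zu by simp
    define w where "w = 1 / (1 / u - 1)"
    have w: "0 < w" "w < 1" using u3 by (auto simp: w_def)
    have "unshift (G z) = w" using Gz w by (simp add: unshift_def w_def)
    moreover have "G_alpha 1 w = G_alpha 1 u"
    proof -
      have "1 / w = 1 / u - 1" by (simp add: w_def)
      then have "\<lfloor>1 / w\<rfloor> = \<lfloor>1 / u\<rfloor> - 1" by linarith
      then show ?thesis using w u \<open>1 / w = 1 / u - 1\<close> by (simp add: G_alpha_def)
    qed
    ultimately show ?thesis using 3 by (simp add: advance_def u_def)
  qed
qed

definition advance_time :: "real \<Rightarrow> nat \<Rightarrow> nat" where
  "advance_time z n = (\<Sum>m<n. advance ((G ^^ m) z))"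

lemma G1_funpow_advance_time:
  assumes z: "z \<in> I" "z \<notin> \<rat>"
  shows "G_alpha 1 (unshift ((G ^^ n) z)) = (G_alpha 1 ^^ advance_time z n) (G_alpha 1 (unshift z))"
proof (induction n)
  case (Suc n)
  have "G_alpha 1 (unshift ((G ^^ Suc n) z)) = (G_alpha 1 ^^ advance ((G ^^ n) z)) (G_alpha 1 (unshift ((G ^^ n) z)))"
    using G1_unshift_G[OF funpow_in_I[OF z(1)] funpow_irrational[OF z(2)]] by simp
  also have "\<dots> = (G_alpha 1 ^^ (advance ((G ^^ n) z) + advance_time z n)) (G_alpha 1 (unshift z))"
    unfolding Suc by (simp add: funpow_add)
  finally show ?case by (simp add: advance_time_def add.commute)
qed (simp add: advance_time_def)

lemma visits_advance_time:
  assumes z: "z \<in> I" "z \<notin> \<rat>"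
  shows "visits (G_alpha 1) (G_alpha 1 (unshift z)) E (advance_time z n) =
    visits G z (first_part E) n + visits G z (second_part E) n"
proof (induction n)
  case (Suc n)
  let ?z = "(G ^^ n) z"
  have s: "visits f x A (Suc n) = visits f x A n + (if (f ^^ n) x \<in> A then 1 else 0)" for f x A
    using visits_add[of f x A n 1] visits_Suc[of f "(f ^^ n) x" A 0] by simp
  have "visits (G_alpha 1) (G_alpha 1 (unshift z)) E (advance_time z (Suc n)) =
    visits (G_alpha 1) (G_alpha 1 (unshift z)) E (advance_time z n) +
    visits (G_alpha 1) (G_alpha 1 (unshift ?z)) E (advance ?z)"
    unfolding G1_funpow_advance_time[OF z] by (simp add: advance_time_def visits_add)
  also have "visits (G_alpha 1) (G_alpha 1 (unshift ?z)) E (advance ?z) =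
    (if ?z \<in> first_part E then 1 else 0) + (if ?z \<in> second_part E then 1 else 0)"
    by (simp add: advance_def first_part_def second_part_def numeral_2_eq_2 visits_Suc)
  finally show ?case using Suc unfolding s by simp
qed (simp add: advance_time_def)

lemma countable_frontier_unshift_vimage:
  assumes "countable (frontier A)" shows "countable (frontier (unshift -` A))"
proof (rule countable_frontier_vimage[of "{0}", OF _ _ _ assms])
  fix x :: real assume x: "x \<notin> {0}"
  have "\<forall>\<^sub>F u in nhds x. unshift u = (if x < 0 then u + 1 else u)"
  proof (cases "x < 0")
    case True
    have "\<forall>\<^sub>F u in nhds x. u \<in> {..<0}" using True by (intro eventually_nhds_in_open) auto
    then show ?thesis by eventually_elim (use True in \<open>simp add: unshift_def\<close>)
  next
    case False
    have "\<forall>\<^sub>F u in nhds x. u \<in> {0<..}" using False x by (intro eventually_nhds_in_open) auto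
    then show ?thesis by eventually_elim (use False in \<open>simp add: unshift_def\<close>)
  qed
  then have "isCont unshift x \<longleftrightarrow> isCont (\<lambda>u. if x < 0 then u + 1 else u) x" by (rule isCont_cong)
  then show "isCont unshift x" by (cases "x < 0") simp_all
next
  fix c show "countable (unshift -` {c})"
    by (rule countable_subset[of _ "{c, c - 1}"]) (auto simp: unshift_def split: if_splits)
qed simp

lemma countable_frontier_parts:
  assumes "countable (frontier E)"
  shows "countable (frontier (first_part E))" "countable (frontier (second_part E))"
  unfolding first_part_def second_part_def
  by (intro countable_frontier_Int countable_frontier_unshift_vimage gauss.countable_frontier_G_vimage
      countable_frontier_greaterThan countable_frontier_lessThan assms)+

text \<open>The last step of a block with \<open>u \<ge> \<alpha>\<close> is at
  \<open>1 / t - 1\<close> with \<open>1 \<le> t < 2\<close>, hence above -1/2, and a block has at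
  most \<open>nat \<lceil>1 / \<alpha>\<rceil>\<close> steps.\<close>

lemma visits_greater_minus_half:
  assumes z: "z \<in> I" "z \<notin> \<rat>"
  shows "1 \<le> visits G z {- 1 / 2<..} (nat \<lceil>1 / \<alpha>\<rceil>)"
proof -
  define u where "u = unshift z"
  have u: "0 < u" "u < 1" "u \<notin> \<rat>" using unshift_bounds[OF z] by (auto simp: u_def)
  have zu: "z = shift u" using shift_unshift[OF z(1)] by (simp add: u_def)
  have h: "1 \<le> height u" "height u \<le> nat \<lceil>1 / \<alpha>\<rceil>" using height_pos[OF u(1,2)] height_le[OF u(1)] by auto
  have "- 1 / 2 < (G ^^ (height u - 1)) z"
  proof (cases "u < \<alpha>")
    case True
    then show ?thesis using u by (simp add: zu height_def shift_def)
  next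
    case False
    define t where "t = 1 / u - real (height u - 1)"
    have "1 / u < real (height u) + 1" using False floor_recip_pos[OF u(1,2)]
      by (simp add: height_def) linarith
    moreover have "real (height u) \<le> 1 / u" using False floor_recip_pos[OF u(1,2)]
      by (simp add: height_def) linarith
    ultimately have t: "1 \<le> t" "t < 2" using h by (auto simp: t_def of_nat_diff)
    have "(G ^^ (height u - 1)) z = 1 / t - 1"
      unfolding zu t_def using False u h by (intro funpow_in_block) (auto simp: height_def)
    moreover have "1 / 2 < 1 / t" using t by (simp add: field_simps)
    ultimately show ?thesis by linarith
  qed
  then have "{height u - 1} \<subseteq> {m. m < nat \<lceil>1 / \<alpha>\<rceil> \<and> (G ^^ m) z \<in> {- 1 / 2<..}}" using h by auto
  then have "card {height u - 1} \<le> visits G z {- 1 / 2<..} (nat \<lceil>1 / \<alpha>\<rceil>)"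
    unfolding visits_def by (intro card_mono) auto
  then show ?thesis by simp
qed

end

context two_acips
begin

text \<open>Integrating the count of visits, which is almost surely at least 1, gives
  \<open>1 \<le> ?K * measure M ?A\<close>. This keeps the mean advance per step of \<open>G\<close>
  positive.\<close>

lemma measure_greater_minus_half: "0 < measure M ({- 1 / 2<..} \<inter> I)"
proof -
  let ?A = "{- 1 / 2<..} \<inter> I" and ?K = "nat \<lceil>1 / \<alpha>\<rceil>"
  have A: "?A \<in> sets M" using I_borel by (auto simp: mem_sets_M)
  have "AE x in M. x \<notin> \<rat>"
    by (rule AE_M_of_lborel) (use AE_not_in[OF countable_imp_null_set_lborel[OF countable_rat]] in auto)
  then have "AE x in M. 1 \<le> real (visits G x ?A ?K)"
    using AE_space
  proof eventually_elim
    case (elim x)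
    then have x: "x \<in> I" by (simp add: space_M)
    have "visits G x ?A ?K = visits G x {- 1 / 2<..} ?K"
      using funpow_in_I[OF x] by (auto simp: visits_def)
    then show ?case using visits_greater_minus_half[OF x elim(1)] by simp
  qed
  moreover have "integrable M (\<lambda>x. real (visits G x ?A ?K))"
    using measurable_visits[OF measurable_G_M A, of ?K] visits_le[of G _ ?A ?K]
    by (intro integrable_const_bound[where B = "real ?K"]) auto
  ultimately have "(\<integral>x. 1 \<partial>M) \<le> (\<integral>x. real (visits G x ?A ?K) \<partial>M)"
    by (intro integral_mono_AE) auto
  then have "1 \<le> ?K * measure M ?A" unfolding integral_visits[OF measurable_G_M distr_G_M A] by (simp add: prob_space)
  then show ?thesis by (metis less_eq_real_def measure_nonneg mult_zero_right not_one_le_zero)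
qed

text \<open>\<open>S UNIV\<close> is the mean advance of the Gauss orbit per step of
  \<open>G\<close>. The limit is expressed by \<open>M\<close> alone and so does not depend on
  \<open>z\<close>.\<close>

lemma gauss_visits_lim:
  assumes z: "normal z" and E: "countable (frontier E)"
  defines "S \<equiv> \<lambda>E. measure M (first_part E \<inter> I) + measure M (second_part E \<inter> I)"
  shows "(\<lambda>m. visits (G_alpha 1) (unshift z) E m / m) \<longlonglongrightarrow> S E / S UNIV"
proof -
  have zI: "z \<in> I" "z \<notin> \<rat>" using z by (auto simp: normal_def)
  have lim: "(\<lambda>n. visits (G_alpha 1) (G_alpha 1 (unshift z)) B (advance_time z n) / n) \<longlonglongrightarrow> S B"
    if "countable (frontier B)" for B
    unfolding visits_advance_time[OF zI] of_nat_add add_divide_distrib S_def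
    using z countable_frontier_parts[OF that] unfolding normal_def by (intro tendsto_add) blast+
  have "(\<lambda>m. visits (G_alpha 1) (G_alpha 1 (unshift z)) E m / m) \<longlonglongrightarrow> S E / S UNIV"
  proof (rule LIMSEQ_div_time_change[where N = "advance_time z" and K = 2])
    show "(\<lambda>n. advance_time z n / n) \<longlonglongrightarrow> S UNIV" using lim[of UNIV] by (simp add: visits_UNIV)
    have "first_part UNIV = {- 1 / 2<..}" by (simp add: first_part_def)
    then have "measure M ({- 1 / 2<..} \<inter> I) \<le> S UNIV" by (simp add: S_def)
    then show "0 < S UNIV" using measure_greater_minus_half by linarith
    show "advance_time z n \<le> advance_time z (Suc n)" "advance_time z (Suc n) \<le> advance_time z n + 2" for n
      by (simp_all add: advance_time_def advance_def)
    show "advance_time z 0 = 0" by (simp add: advance_time_def)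
  qed (simp_all add: lim E visits_mono_time)
  then show ?thesis by (simp only: visits_lim_step)
qed

lemma full_normal_unshift:
  assumes z: "normal z" shows "full.normal (unshift z)"
proof -
  obtain y where y: "full.normal y" using full.ex_normal by blast
  have uy: "unshift (shift y) = y" using full_normal_bounds[OF y] by (intro unshift_shift) auto
  have "(\<lambda>m. visits (G_alpha 1) (unshift z) E m / m) \<longlonglongrightarrow> measure M1 (E \<inter> full.I)"
    if E: "countable (frontier E)" for E
  proof -
    have "(\<lambda>m. visits (G_alpha 1) y E m / m) \<longlonglongrightarrow> measure M1 (E \<inter> full.I)"
      using y E by (auto simp: full.normal_def)
    then show ?thesis
      using gauss_visits_lim[OF normal_shift_of_full_normal[OF y] E] gauss_visits_lim[OF z E] LIMSEQ_unique
      unfolding uy by metis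
  qed
  moreover have "unshift z \<in> full.I" "unshift z \<notin> \<rat>"
    using unshift_bounds[of z] z by (auto simp: normal_def gauss_I)
  ultimately show ?thesis by (auto simp: full.normal_def)
qed

lemma full_normal_iff: 
  assumes "0 < y" "y < 1" shows "full.normal y \<longleftrightarrow> normal (shift y)"
  using normal_shift_of_full_normal full_normal_unshift[of "shift y"] unshift_shift[of y] assms by auto

end

lemma (in alpha_acip) normal_wrt_iff:
  assumes "\<mu> \<alpha> = M" shows "normal_wrt \<mu> \<alpha> x \<longleftrightarrow> normal x"
  unfolding normal_wrt_def normal_iff_cylinders visits_def assms by auto

lemma (in alpha_acip) alpha_normal_iff:
  assumes "\<mu> \<alpha> = M" "x \<in> {0<..<1} - \<rat>"
  shows "alpha_normal \<mu> \<alpha> x \<longleftrightarrow> normal (shift x)"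
  unfolding alpha_normal_def normal_wrt_iff[of \<mu>, OF assms(1)] using assms(2) by (auto simp: shift_def)

theorem theorem4:
  fixes \<alpha> :: real and \<mu> :: "real \<Rightarrow> real measure"
  assumes "0 < \<alpha>" and "\<alpha> \<le> 1"
    and "is_acip \<alpha> (\<mu> \<alpha>)" and "is_acip 1 (\<mu> 1)"
  shows "\<forall>x\<in>{0<..<1} - \<rat>. alpha_normal \<mu> \<alpha> x \<longleftrightarrow> alpha_normal \<mu> 1 x"
proof
  fix x assume x: "x \<in> {0<..<1::real} - \<rat>"
  interpret two_acips \<alpha> "\<mu> \<alpha>" "\<mu> 1" using assms by unfold_locales simp_all
  \<comment> \<open>For parameter 1 the identification modulo 1 is trivial on the unit interval, so
    both sides speak about the same point.\<close>
  have "gauss.shift x = x" using x by (simp add: gauss.shift_def)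
  then show "alpha_normal \<mu> \<alpha> x \<longleftrightarrow> alpha_normal \<mu> 1 x"
    using alpha_normal_iff[of \<mu>, OF refl x] full.alpha_normal_iff[of \<mu>, OF refl x] full_normal_iff[of x] x by simp
qed

end
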